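(* Let $R$ be a preparation map. On $\mathcal T_0$, for every space-time point $x$, $$\delta\Pi_x^{R,1}=\Pi_x^{R,1}D_\Xi ,$$ i.e. $\delta(\Pi_x^{R,1}\tau)=\Pi_x^{R,1}(D_\Xi\tau)$ for every $\tau\in\mathcal T_0$.
   Context: **Trees.** Fix $d\ge 1$. For $k=(k_0,\dots,k_d)\in\mathbb N^{d+1}$ put $|k|=2k_0+k_1+\dots+k_d$ and $k!=\prod_jk_j!$. A decorated tree is a non-planar rooted tree with node decorations in $\mathbb N^{d+1}$ and edge decorations in $\{\mathcal I,\Xi_0,\Xi_1\}\times\mathbb N^{d+1}$. $T$ is the set of decorated trees, $\mathcal T$ its linear span. The tree product identifies the roots and adds their decorations; its unit $\mathbf 1$ is the single node decorated by $0$. $X^k$ is the single node decorated by $k$, $X_j=X^{e_j}$ ($j=0,\dots,d$); $\Xi_i$ is the tree with one edge, decorated by $(\Xi_i,0)$; $\mathcal I_a(\tau)$ grafts $\tau$ onto a new root (decorated $0$) via an edge decorated by $(\mathcal I,a)$ (a planted tree). Trees have the form $X^k\Xi_0^l\Xi_1^m\prod_{i}\mathcal I_{a_i}(\tau_i)$ with $l+m\le1$. $|\tau|_\Xi$ is the number of noises $\Xi_0,\Xi_1$ in $\tau$. **Degrees.** Let $\alpha\in\mathbb R$ be the space-time regularity of the noise $\xi$. Put $\deg_0(\Xi_0)=\deg_1(\Xi_0)=\deg_1(\Xi_1)=\alpha$, $\deg_0(\Xi_1)=\alpha+\frac{d+2}2$, and for $i=0,1$: $\deg_i(X^k)=|k|$,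 $\deg_i$ is additive for the tree product, $\deg_i(\mathcal I_a(\tau))=\deg_i(\tau)+2-|a|$. **Spaces.** $T_0\subset T$ is the set of trees (without $\Xi_1$) generated by a fixed normal complete rule associated with a subcritical singular SPDE $u=K*(F(u,\nabla u,\dots)\xi+G(u,\nabla u,\dots))$ on $\mathbb R_+\times\mathbb R^d$; $\mathcal T_0$ is its span, which is stable under the preparation map $R$ and under the coactions below. $T_1$ is the set of trees obtained from trees in $T_0$ by replacing at most one $\Xi_0$ by $\Xi_1$; $\mathcal T_1$ is its span. $\mathcal T^{+,i}$ is the algebra spanned by $X^k\prod_j\mathcal I^{+,i}_{a_j}(\tau_j)$ with $\tau_j\in T$, $\deg_i(\mathcal I_{a_j}(\tau_j))>0$; $\mathcal I^{+,i}_a$ is a new symbol, extended linearly, with $\mathcal I^{+,i}_a(\tau)=0$ if $\deg_i(\mathcal I_a(\tau))\le0$. **Coactions.** $\Delta_i$ (with values in $\mathcal T\otimes\mathcal T^{+,i}$) is linear and multiplicative with $\Delta_i\mathbf 1=\mathbf 1\otimes\mathbf 1$, $\Delta_iX_j=X_j\otimes\mathbf 1+\mathbf 1\otimes X_j$, $\Delta_i\Xi_j=\Xi_j\otimes\mathbf 1$, $\Delta_i\mathcal I_a\tau=(\mathcal I_a\otimes\mathrm{Id})\Delta_i\tau+\sum_{|\ell+m|<\deg_i(\mathcal I_a\tau)}\frac{X^\ell}{\ell!}\otimes\frac{X^m}{m!}\mathcal I^{+,i}_{a+\ell+m}(\tau)$. **Malliavin derivative on trees.** $D_\Xi:\mathcal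 T_0\to\mathcal T_1$ is linear, satisfies the Leibniz rule for the tree product, and $D_\Xi\Xi_0=\Xi_1$, $D_\Xi X^k=0$, $D_\Xi\mathbf 1=0$, $D_\Xi\mathcal I_a(\tau)=\mathcal I_a(D_\Xi\tau)$. **Preparation map.** A linear map $R:\mathcal T\to\mathcal T$ fixing polynomials $X^k$, noises and planted trees such that: for each tree $\tau$, $R\tau=\tau+\sum_j\lambda_j\tau_j$ (finite sum) with $\deg_1(\tau_j)\ge\deg_1(\tau)$ and $|\tau_j|_\Xi<|\tau|_\Xi$; $(R\otimes\mathrm{Id})\Delta_i=\Delta_iR$ for $i=0,1$; and $RD_\Xi=D_\Xi R$ on $\mathcal T_0$. **Model.** $K$ is the compactly supported truncation of the kernel (heat kernel) of the SPDE, $\xi$ is the regularised (smooth) noise and $\delta\xi$ an arbitrary infinitesimal (smooth) perturbation of it. $\Pi_x^{R,1}\tau=\hat\Pi_x^{R,1}R\tau$, $\hat\Pi^{R,1}_x$ is multiplicative, $\hat\Pi_x^{R,1}X^k=(\cdot-x)^k$, $\hat\Pi_x^{R,1}\Xi_0=\xi$, $\hat\Pi_x^{R,1}\Xi_1=\delta\xi$, and $(\hat\Pi_x^{R,1}\mathcal I_a\tau)(y)=(D^aK*\Pi_x^{R,1}\tau)(y)-\sum_{|k|<\deg_1(\mathcal I_a\tau)}\frac{(y-x)^k}{k!}(D^{a+k}K*\Pi_x^{R,1}\tau)(x)$. $\delta$ denotes the Malliavin derivative, i.e. the Fréchet derivative with respect to the noise $\xi$, taken in the direction $\delta\xi$;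 $R$ does not depend on $\xi$. *)

theory Defs
  imports "HOL-Analysis.Analysis" "HOL-Library.Poly_Mapping"
begin

section \<open>Space-time and multi-indices\<close>

text \<open>The spatial dimension is \<open>d = CARD('d) \<ge> 1\<close>. The index set \<open>{0,\<dots>,d}\<close> is
  rendered by \<open>'d option\<close>: \<open>None\<close> is the time coordinate \<open>0\<close>, \<open>Some i\<close> a space coordinate.\<close>

type_synonym 'd st = "real ^ ('d option)"
type_synonym 'd mi = "nat ^ ('d option)"

definition sdeg :: "'d::finite mi \<Rightarrow> nat" where
  "sdeg k = 2 * (k $ None) + (\<Sum>i\<in>UNIV. k $ Some i)"

definition mfact :: "'d::finite mi \<Rightarrow> real" where
  "mfact k = (\<Prod>j\<in>UNIV. fact (k $ j))"

definition mpow :: "'d::finite st \<Rightarrow> 'd mi \<Rightarrow> real" where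
  "mpow z k = (\<Prod>j\<in>UNIV. (z $ j) ^ (k $ j))"


section \<open>Decorated trees\<close>

text \<open>\<open>Kern\<close> is the edge type \<open>\<I>\<close>. A node carries its decoration and the multiset of the
  outgoing edges (with decorations), each with the subtree above it.\<close>

datatype etype = Kern | Xi0 | Xi1

datatype (dead 'd::finite) tree =
  Node "nat ^ ('d option)" "((etype \<times> (nat ^ ('d option))) \<times> 'd tree) multiset"

text \<open>The commutative monoid of trees under the tree product is written additively, so that
  the convolution product of \<open>HOL-Library.Poly_Mapping\<close> is the bilinear extension of the tree
  product. In particular the unit tree is \<open>0 :: 'd tree\<close>.\<close>

instantiation tree :: (finite) comm_monoid_add
begin
definition zero_tree :: "'a tree" where "zero_tree = Node 0 {#}"
fun plus_tree :: "'a tree \<Rightarrow> 'a tree \<Rightarrow> 'a tree" where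
  "plus_tree (Node k M) (Node l N) = Node (k + l) (M + N)"
instance
proof
  fix a b c :: "'a tree"
  show "a + b + c = a + (b + c)" by (cases a; cases b; cases c) (simp add: add.assoc)
  show "a + b = b + a" by (cases a; cases b) (simp add: add.commute)
  show "0 + a = a" by (cases a) (simp add: zero_tree_def)
qed
end

definition Xpow :: "'d::finite mi \<Rightarrow> 'd tree" where
  "Xpow k = Node k {#}"

definition noise :: "etype \<Rightarrow> 'd::finite tree" where
  "noise e = Node 0 {#((e, 0), 0)#}"

definition plant :: "'d::finite mi \<Rightarrow> 'd tree \<Rightarrow> 'd tree" where
  "plant a t = Node 0 {#((Kern, a), t)#}"

text \<open>The set \<open>T\<close>: trees of the form \<open>X\<^sup>k \<Xi>\<^sub>0\<^sup>l \<Xi>\<^sub>1\<^sup>m \<Prod>\<^sub>i \<I>\<^bsub>a\<^sub>i\<^esub>(\<tau>\<^sub>i)\<close> with \<open>l + m \<le> 1\<close>, recursively.\<close>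

inductive_set trees :: "'d::finite tree set" where
  "\<lbrakk>size {#c \<in># M. fst (fst c) \<noteq> Kern#} \<le> 1;
    \<And>a t. ((Kern, a), t) \<in># M \<Longrightarrow> t \<in> trees;
    \<And>e a t. ((e, a), t) \<in># M \<Longrightarrow> e \<noteq> Kern \<Longrightarrow> a = 0 \<and> t = 0\<rbrakk>
   \<Longrightarrow> Node k M \<in> trees"

lemma size_child [termination_simp]:
  "(e, t) \<in># M \<Longrightarrow> size t < Suc (size_multiset (\<lambda>c. Suc (size (fst c) + size (snd c))) M)"
  by (induction M) auto

fun noises :: "'d::finite tree \<Rightarrow> nat" where
  "noises (Node k M) = (\<Sum>(e, t)\<in>#M. (if fst e = Kern then 0 else 1) + noises t)"

text \<open>The degree \<open>deg\<^sub>i\<close>, \<open>i \<in> {0, 1}\<close>; \<open>\<alpha>\<close> is the regularity of the noise.\<close>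

fun edeg :: "real \<Rightarrow> 'd::finite itself \<Rightarrow> nat \<Rightarrow> etype \<Rightarrow> real" where
  "edeg \<alpha> _ i Kern = 2"
| "edeg \<alpha> _ i Xi0 = \<alpha>"
| "edeg \<alpha> _ i Xi1 = (if i = 0 then \<alpha> + (real CARD('d) + 2) / 2 else \<alpha>)"

fun deg :: "real \<Rightarrow> nat \<Rightarrow> 'd::finite tree \<Rightarrow> real" where
  "deg \<alpha> i (Node k M) = real (sdeg k) +
     (\<Sum>(e, t)\<in>#M. edeg \<alpha> TYPE('d) i (fst e) - real (sdeg (snd e)) + deg \<alpha> i t)"


section \<open>Linear spaces and linear maps\<close>

text \<open>The free vector space over a set \<open>B\<close> is the set of \<open>p :: 'b \<Rightarrow>\<^sub>0 real\<close> with \<open>keys p \<subseteq> B\<close>.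
  A linear map is given by its values on the basis and is applied to a general element
  through its linear extension.\<close>

abbreviation vec1 :: "'b \<Rightarrow> 'b \<Rightarrow>\<^sub>0 real" where
  "vec1 b \<equiv> Poly_Mapping.single b 1"

definition lin_ext :: "('b \<Rightarrow> 'c \<Rightarrow>\<^sub>0 real) \<Rightarrow> ('b \<Rightarrow>\<^sub>0 real) \<Rightarrow> ('c \<Rightarrow>\<^sub>0 real)" where
  "lin_ext f p = (\<Sum>b\<in>Poly_Mapping.keys p. Poly_Mapping.map ((*) (Poly_Mapping.lookup p b)) (f b))"

definition lin_fun :: "('b \<Rightarrow> 'x \<Rightarrow> real) \<Rightarrow> ('b \<Rightarrow>\<^sub>0 real) \<Rightarrow> ('x \<Rightarrow> real)" where
  "lin_fun f p = (\<lambda>y. \<Sum>b\<in>Poly_Mapping.keys p. Poly_Mapping.lookup p b * f b y)"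

text \<open>The tensor product of two free vector spaces is the free vector space over the pairs;
  its (componentwise) product is again the convolution product.\<close>

definition tensor :: "('b \<Rightarrow>\<^sub>0 real) \<Rightarrow> ('c \<Rightarrow>\<^sub>0 real) \<Rightarrow> ('b \<times> 'c \<Rightarrow>\<^sub>0 real)" where
  "tensor p q = (\<Sum>b\<in>Poly_Mapping.keys p. \<Sum>c\<in>Poly_Mapping.keys q.
     Poly_Mapping.single (b, c) (Poly_Mapping.lookup p b * Poly_Mapping.lookup q c))"


section \<open>Coactions\<close>

text \<open>\<open>(k, {#(a\<^sub>1, \<tau>\<^sub>1), \<dots>#})\<close> is the monomial \<open>X\<^sup>k \<Prod>\<^sub>j \<I>\<^sup>+\<^bsub>a\<^sub>j\<^esub>(\<tau>\<^sub>j)\<close>. The spaces \<open>\<T>\<^sup>+\<^sup>,\<^sup>0\<close> and \<open>\<T>\<^sup>+\<^sup>,\<^sup>1\<close>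
  are never mixed and share this type; they differ by the degree condition in \<open>Iplus\<close>.\<close>

type_synonym 'd plus_mon = "'d mi \<times> ('d mi \<times> 'd tree) multiset"

definition Iplus :: "real \<Rightarrow> nat \<Rightarrow> 'd::finite mi \<Rightarrow> 'd tree \<Rightarrow> 'd plus_mon \<Rightarrow>\<^sub>0 real" where
  "Iplus \<alpha> i a t = (if deg \<alpha> i (plant a t) > 0 then vec1 (0, {#(a, t)#}) else 0)"

definition Delta_X :: "'d::finite mi \<Rightarrow> ('d tree \<times> 'd plus_mon) \<Rightarrow>\<^sub>0 real" where
  "Delta_X k = (\<Prod>j\<in>UNIV. (vec1 (Xpow (axis j 1), 0) + vec1 (0, (axis j 1, {#}))) ^ (k $ j))"

fun Delta :: "real \<Rightarrow> nat \<Rightarrow> 'd::finite tree \<Rightarrow> ('d tree \<times> 'd plus_mon) \<Rightarrow>\<^sub>0 real" where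
  "Delta \<alpha> i (Node k M) = Delta_X k * (\<Prod>(e, t)\<in>#M.
     if fst e = Kern then
       lin_ext (\<lambda>(s, w). vec1 (plant (snd e) s, w)) (Delta \<alpha> i t) +
       (\<Sum>(l, m) \<in> {(l, m). real (sdeg (l + m)) < deg \<alpha> i (plant (snd e) t)}.
          tensor (Poly_Mapping.single (Xpow l) (1 / mfact l))
                 (Poly_Mapping.single (m, {#}) (1 / mfact m) * Iplus \<alpha> i (snd e + l + m) t))
     else vec1 (Node 0 {#(e, t)#}, 0))"


section \<open>The derivative on trees\<close>

text \<open>The Leibniz rule unrolled over all edges at the root.\<close>

fun D_Xi :: "'d::finite tree \<Rightarrow> 'd tree \<Rightarrow>\<^sub>0 real" where
  "D_Xi (Node k M) = (\<Sum>(e, t)\<in>#M. vec1 (Node k (M - {#(e, t)#})) *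
     (case fst e of
        Kern \<Rightarrow> lin_ext (\<lambda>s. vec1 (plant (snd e) s)) (D_Xi t)
      | Xi0 \<Rightarrow> vec1 (Node 0 {#((Xi1, snd e), t)#})
      | Xi1 \<Rightarrow> 0))"


section \<open>Rules and the trees they generate\<close>

text \<open>A node type is the multiset of decorated edges leaving a node; a rule assigns to an edge
  type the node types allowed at the end of such an edge. Only the types \<open>Kern\<close>, \<open>Xi0\<close> are
  governed by the rule; \<open>Xi1\<close> is introduced only by \<open>D_Xi\<close>.\<close>

type_synonym 'd ntype = "(etype \<times> 'd mi) multiset"
type_synonym 'd srule = "etype \<Rightarrow> 'd ntype set"

inductive conforms :: "'d::finite srule \<Rightarrow> etype \<Rightarrow> 'd tree \<Rightarrow> bool" for rl where
  "\<lbrakk>image_mset fst M \<in> rl t; \<And>e a s. ((e, a), s) \<in># M \<Longrightarrow> conforms rl e s\<rbrakk>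
   \<Longrightarrow> conforms rl t (Node k M)"

text \<open>The trees strongly conforming to the rule, i.e. at every node including the root.\<close>

definition T0 :: "'d::finite srule \<Rightarrow> 'd tree set" where
  "T0 rl = {\<tau> \<in> trees. \<exists>t\<in>{Kern, Xi0}. conforms rl t \<tau>}"

text \<open>Node types compatible with \<open>u = K * (F(u,\<nabla>u,\<dots>) \<xi> + G(u,\<nabla>u,\<dots>))\<close>: at most one noise,
  multiplied by (derivatives of) \<open>u\<close>; nothing grows out of a noise.\<close>

definition spde_rule :: "'d::finite srule \<Rightarrow> bool" where
  "spde_rule rl \<longleftrightarrow> rl Xi0 = {{#}} \<and>
     (\<forall>N\<in>rl Kern. \<exists>A. N = image_mset (Pair Kern) A \<or> N = add_mset (Xi0, 0) (image_mset (Pair Kern) A))"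

definition normal_rule :: "'d::finite srule \<Rightarrow> bool" where
  "normal_rule rl \<longleftrightarrow>
     (\<forall>t\<in>{Kern, Xi0}. rl t \<noteq> {} \<and> (\<forall>N\<in>rl t. \<forall>M. M \<subseteq># N \<longrightarrow> M \<in> rl t))"

text \<open>There is \<open>reg\<close> with \<open>reg t < |t| + inf {reg N | N \<in> rl t}\<close>; the bound \<open>c\<close> expresses that
  the infimum may be \<open>- \<infinity>\<close>.\<close>

definition subcritical_rule :: "real \<Rightarrow> 'd::finite srule \<Rightarrow> bool" where
  "subcritical_rule \<alpha> rl \<longleftrightarrow> (\<exists>reg :: etype \<Rightarrow> real. \<forall>t\<in>{Kern, Xi0}. \<exists>c. reg t < c \<and>
     (\<forall>N\<in>rl t. c \<le> edeg \<alpha> TYPE('d) 1 t + (\<Sum>(e, a)\<in>#N. reg e - real (sdeg a))))"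

definition neg_trees :: "real \<Rightarrow> 'd::finite srule \<Rightarrow> 'd tree set" where
  "neg_trees \<alpha> rl = {Node 0 M | M. Node 0 M \<in> T0 rl \<and> deg \<alpha> 1 (Node 0 M) < 0 \<and>
     (\<forall>e a s. M = {#((e, a), s)#} \<longrightarrow> edeg \<alpha> TYPE('d) 1 e < 0)}"

text \<open>\<open>attach rl t \<tau> N\<close>: node types \<open>P\<^sub>x\<close> can be added at the nodes \<open>x\<close> of \<open>\<tau>\<close> such that the
  result conforms to the rule at all nodes (with \<open>t\<close> the edge type at the root), and \<open>N\<close> is the
  sum of the \<open>P\<^sub>x\<close>. It describes the node types that may appear when \<open>\<tau>\<close> is contracted.\<close>

inductive attach :: "'d::finite srule \<Rightarrow> etype \<Rightarrow> 'd tree \<Rightarrow> 'd ntype \<Rightarrow> bool" for rl where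
  "\<lbrakk>image_mset (\<lambda>(c, Q). fst c) C + P \<in> rl t;
    \<And>e a s Q. (((e, a), s), Q) \<in># C \<Longrightarrow> attach rl e s Q\<rbrakk>
   \<Longrightarrow> attach rl t (Node k (image_mset fst C)) (P + (\<Sum>(c, Q)\<in>#C. Q))"

definition deriv_ntypes :: "'d::finite mi \<Rightarrow> 'd ntype \<Rightarrow> 'd ntype set" where
  "deriv_ntypes m N = {image_mset (\<lambda>((e, a), l). (e, a + l)) C | C.
     image_mset fst C = N \<and> (\<Sum>(c, l)\<in>#C. l) = m}"

text \<open>Completeness in the sense of Bruned, Hairer and Zambotti.\<close>

definition complete_rule :: "real \<Rightarrow> 'd::finite srule \<Rightarrow> bool" where
  "complete_rule \<alpha> rl \<longleftrightarrow>
     (\<forall>\<tau>\<in>neg_trees \<alpha> rl. \<forall>t\<in>{Kern, Xi0}. \<forall>N m. attach rl t \<tau> N \<longrightarrow>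
        deg \<alpha> 1 \<tau> + real (sdeg m) < 0 \<longrightarrow> deriv_ntypes m N \<subseteq> rl t)"


section \<open>Preparation maps\<close>

text \<open>The last clause is the standing assumption that \<open>\<T>\<^sub>0\<close> is stable under \<open>R\<close>.\<close>

definition preparation_map ::
  "real \<Rightarrow> 'd::finite srule \<Rightarrow> ('d tree \<Rightarrow> 'd tree \<Rightarrow>\<^sub>0 real) \<Rightarrow> bool" where
  "preparation_map \<alpha> rl R \<longleftrightarrow>
     (\<forall>\<tau>\<in>trees. Poly_Mapping.keys (R \<tau>) \<subseteq> trees) \<and>
     (\<forall>k. R (Xpow k) = vec1 (Xpow k)) \<and>
     (\<forall>e\<in>{Xi0, Xi1}. R (noise e) = vec1 (noise e)) \<and>
     (\<forall>a. \<forall>\<tau>\<in>trees. R (plant a \<tau>) = vec1 (plant a \<tau>)) \<and>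
     (\<forall>\<tau>\<in>trees. \<forall>\<sigma>\<in>Poly_Mapping.keys (R \<tau> - vec1 \<tau>).
        deg \<alpha> 1 \<sigma> \<ge> deg \<alpha> 1 \<tau> \<and> noises \<sigma> < noises \<tau>) \<and>
     (\<forall>i\<in>{0, 1}. \<forall>\<tau>\<in>trees.
        lin_ext (\<lambda>(s, w). tensor (R s) (vec1 w)) (Delta \<alpha> i \<tau>) = lin_ext (Delta \<alpha> i) (R \<tau>)) \<and>
     (\<forall>\<tau>\<in>T0 rl. lin_ext R (D_Xi \<tau>) = lin_ext D_Xi (R \<tau>)) \<and>
     (\<forall>\<tau>\<in>T0 rl. Poly_Mapping.keys (R \<tau>) \<subseteq> T0 rl)"


section \<open>Smooth functions and Frechet derivatives\<close>

definition partial :: "'n::finite \<Rightarrow> (real ^ 'n \<Rightarrow> real) \<Rightarrow> (real ^ 'n \<Rightarrow> real)" where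
  "partial j f = (\<lambda>x. frechet_derivative f (at x) (axis j 1))"

definition partials :: "'n::finite list \<Rightarrow> (real ^ 'n \<Rightarrow> real) \<Rightarrow> (real ^ 'n \<Rightarrow> real)" where
  "partials js f = foldr partial js f"

definition smooth_on :: "(real ^ 'n::finite) set \<Rightarrow> (real ^ 'n \<Rightarrow> real) \<Rightarrow> bool" where
  "smooth_on S f \<longleftrightarrow> (\<forall>js. \<forall>x\<in>S. partials js f differentiable (at x))"

abbreviation smooth :: "(real ^ 'n::finite \<Rightarrow> real) \<Rightarrow> bool" where
  "smooth \<equiv> smooth_on UNIV"

text \<open>\<open>D\<^sup>a f\<close>; for smooth \<open>f\<close> the order of the partial derivatives is immaterial.\<close>

definition Dmulti :: "nat ^ 'n::finite \<Rightarrow> (real ^ 'n \<Rightarrow> real) \<Rightarrow> (real ^ 'n \<Rightarrow> real)" where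
  "Dmulti a f = partials (SOME js. \<forall>j. count_list js j = a $ j) f"

text \<open>The seminorms \<open>cinf_norm n\<close>, \<open>n \<in> \<nat>\<close>, generate the usual Frechet space topology of
  \<open>C\<^sup>\<infinity>\<close> (locally uniform convergence of all derivatives).\<close>

definition cinf_norm :: "nat \<Rightarrow> (real ^ 'n::finite \<Rightarrow> real) \<Rightarrow> real" where
  "cinf_norm n f = (SUP (js, x) \<in> {js. length js \<le> n} \<times> cball 0 (real n). \<bar>partials js f x\<bar>)"

text \<open>\<open>L\<close> is the Frechet derivative at \<open>\<xi>\<close> of \<open>\<Phi> : C\<^sup>\<infinity> \<rightarrow> C\<^sup>\<infinity>\<close>: a continuous linear map such that
  for every seminorm \<open>q\<close> there is a seminorm \<open>p\<close> with
  \<open>q (\<Phi> (\<xi> + h) - \<Phi> \<xi> - L h) = o(p h)\<close> as \<open>p h \<rightarrow> 0\<close>.\<close>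

definition has_cinf_derivative ::
  "((real ^ 'n::finite \<Rightarrow> real) \<Rightarrow> (real ^ 'n \<Rightarrow> real)) \<Rightarrow>
   ((real ^ 'n \<Rightarrow> real) \<Rightarrow> (real ^ 'n \<Rightarrow> real)) \<Rightarrow> (real ^ 'n \<Rightarrow> real) \<Rightarrow> bool" where
  "has_cinf_derivative \<Phi> L \<xi> \<longleftrightarrow>
     (\<forall>h. smooth h \<longrightarrow> smooth (\<Phi> h) \<and> smooth (L h)) \<and>
     (\<forall>h g. smooth h \<longrightarrow> smooth g \<longrightarrow> L (\<lambda>y. h y + g y) = (\<lambda>y. L h y + L g y)) \<and>
     (\<forall>c h. smooth h \<longrightarrow> L (\<lambda>y. c * h y) = (\<lambda>y. c * L h y)) \<and>
     (\<forall>n. \<exists>m C. \<forall>h. smooth h \<longrightarrow> cinf_norm n (L h) \<le> C * cinf_norm m h) \<and>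
     (\<forall>n. \<exists>m. \<forall>\<epsilon>>0. \<exists>r>0. \<forall>h. smooth h \<longrightarrow> cinf_norm m h < r \<longrightarrow>
        cinf_norm n (\<lambda>y. \<Phi> (\<lambda>z. \<xi> z + h z) y - \<Phi> \<xi> y - L h y) \<le> \<epsilon> * cinf_norm m h)"


section \<open>The model\<close>

definition heat_kernel :: "'d::finite st \<Rightarrow> real" where
  "heat_kernel z = (if z $ None > 0
     then (4 * pi * z $ None) powr (- real CARD('d) / 2) *
          exp (- (\<Sum>i\<in>UNIV. (z $ Some i)\<^sup>2) / (4 * z $ None))
     else 0)"

definition truncated_heat_kernel :: "('d::finite st \<Rightarrow> real) \<Rightarrow> bool" where
  "truncated_heat_kernel K \<longleftrightarrow>
     (\<exists>C. compact C \<and> (\<forall>z. z \<notin> C \<longrightarrow> K z = 0)) \<and>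
     (\<exists>r>0. \<forall>z\<in>ball 0 r - {0}. K z = heat_kernel z) \<and>
     smooth_on (- {0}) K"

text \<open>\<open>D\<^sup>a K * f\<close> for smooth \<open>f\<close>. In general \<open>D\<^sup>a K\<close> is not locally integrable and has to be
  understood as a distribution, so that \<open>D\<^sup>a K * f = K * D\<^sup>a f\<close>.\<close>

definition Dconv :: "'d::finite mi \<Rightarrow> ('d st \<Rightarrow> real) \<Rightarrow> ('d st \<Rightarrow> real) \<Rightarrow> ('d st \<Rightarrow> real)" where
  "Dconv a K f = (\<lambda>y. \<integral>z. K z * Dmulti a f (y - z) \<partial>lborel)"

text \<open>The map \<open>\<Pi>\<close>-hat on trees. The sum over \<open>s\<close> is \<open>\<Pi> t\<close>, i.e. the linear extension of
  \<open>\<Pi>\<close>-hat evaluated at \<open>R t\<close>: its restriction to \<open>s = t\<close> or \<open>noises s < noises t\<close> is void for a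
  preparation map (see \<open>Pi_hat_plant\<close> below) and only makes the recursion well-founded for
  arbitrary \<open>R\<close>.\<close>

function Pi_hat :: "real \<Rightarrow> ('d::finite st \<Rightarrow> real) \<Rightarrow> ('d tree \<Rightarrow> 'd tree \<Rightarrow>\<^sub>0 real) \<Rightarrow>
    ('d st \<Rightarrow> real) \<Rightarrow> ('d st \<Rightarrow> real) \<Rightarrow> 'd st \<Rightarrow> 'd tree \<Rightarrow> ('d st \<Rightarrow> real)" where
  "Pi_hat \<alpha> K R \<xi> \<eta> x (Node k M) = (\<lambda>y. mpow (y - x) k * (\<Prod>(e, t)\<in>#M.
     case fst e of
       Xi0 \<Rightarrow> \<xi> y
     | Xi1 \<Rightarrow> \<eta> y
     | Kern \<Rightarrow>
        (let f = (\<lambda>z. \<Sum>s\<in>{s \<in> Poly_Mapping.keys (R t). s = t \<or> noises s < noises t}.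
                    Poly_Mapping.lookup (R t) s * Pi_hat \<alpha> K R \<xi> \<eta> x s z)
         in Dconv (snd e) K f y -
            (\<Sum>m\<in>{m. real (sdeg m) < deg \<alpha> 1 (plant (snd e) t)}.
               mpow (y - x) m / mfact m * Dconv (snd e + m) K f x))))"
  by pat_completeness auto

lemma noises_child: "(e, t) \<in># M \<Longrightarrow> noises t \<le> noises (Node k M)"
  by (induction M) auto

lemma size_child': "(e, t) \<in># M \<Longrightarrow> size t < Suc (size_multiset (size_prod size size) M)"
  by (induction M) auto

termination
proof (relation "measures [\<lambda>(_, _, _, _, _, _, t). noises t, \<lambda>(_, _, _, _, _, _, t). size t]", goal_cases)
  case 1
  show ?case by simp
next
  case 2
  then show ?case
    by (auto simp del: noises.simps intro: size_child'
        le_neq_implies_less noises_child less_le_trans[OF _ noises_child])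
qed

definition Pi_R :: "real \<Rightarrow> ('d::finite st \<Rightarrow> real) \<Rightarrow> ('d tree \<Rightarrow> 'd tree \<Rightarrow>\<^sub>0 real) \<Rightarrow>
    ('d st \<Rightarrow> real) \<Rightarrow> ('d st \<Rightarrow> real) \<Rightarrow> 'd st \<Rightarrow> ('d tree \<Rightarrow>\<^sub>0 real) \<Rightarrow> ('d st \<Rightarrow> real)" where
  "Pi_R \<alpha> K R \<xi> \<eta> x p = lin_fun (Pi_hat \<alpha> K R \<xi> \<eta> x) (lin_ext R p)"

text \<open>The maps above satisfy the characterising identities.\<close>

lemma lin_ext_vec1 [simp]: "lin_ext f (vec1 b) = f b"
  by (simp add: lin_ext_def poly_mapping_eq_iff Poly_Mapping.map.rep_eq fun_eq_iff when_def)

lemma Pi_hat_0: "Pi_hat \<alpha> K R \<xi> \<eta> x 0 y = 1"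
  by (simp add: zero_tree_def mpow_def)

lemma Pi_hat_mult:
  "Pi_hat \<alpha> K R \<xi> \<eta> x (s + t) y = Pi_hat \<alpha> K R \<xi> \<eta> x s y * Pi_hat \<alpha> K R \<xi> \<eta> x t y"
  by (cases s; cases t) (simp add: mpow_def power_add prod.distrib mult_ac)

lemma Pi_hat_X: "Pi_hat \<alpha> K R \<xi> \<eta> x (Xpow k) y = mpow (y - x) k"
  by (simp add: Xpow_def)

lemma Pi_hat_Xi0: "Pi_hat \<alpha> K R \<xi> \<eta> x (noise Xi0) = \<xi>"
  by (simp add: noise_def mpow_def fun_eq_iff)

lemma Pi_hat_Xi1: "Pi_hat \<alpha> K R \<xi> \<eta> x (noise Xi1) = \<eta>"
  by (simp add: noise_def mpow_def fun_eq_iff)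

lemma Pi_hat_plant:
  assumes "preparation_map \<alpha> rl R" and "t \<in> trees"
  shows "Pi_hat \<alpha> K R \<xi> \<eta> x (plant a t) y =
    Dconv a K (Pi_R \<alpha> K R \<xi> \<eta> x (vec1 t)) y -
    (\<Sum>m\<in>{m. real (sdeg m) < deg \<alpha> 1 (plant a t)}.
       mpow (y - x) m / mfact m * Dconv (a + m) K (Pi_R \<alpha> K R \<xi> \<eta> x (vec1 t)) x)"
proof -
  have "s = t \<or> noises s < noises t" if "s \<in> Poly_Mapping.keys (R t)" for s
  proof (cases "s = t")
    case False
    then have "s \<in> Poly_Mapping.keys (R t - vec1 t)"
      using that by (simp add: in_keys_iff lookup_minus lookup_single when_def)
    then show ?thesis
      using assms by (auto simp: preparation_map_def)
  qed simp
  then have *: "{s \<in> Poly_Mapping.keys (R t). s = t \<or> noises s < noises t} = Poly_Mapping.keys (R t)"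
    by blast
  show ?thesis
    by (simp add: plant_def mpow_def Pi_R_def lin_fun_def Let_def * del: deg.simps)
qed

lemma Delta_0: "Delta \<alpha> i 0 = 1"
  by (simp add: zero_tree_def Delta_X_def)

lemma Delta_mult: "Delta \<alpha> i (s + t) = Delta \<alpha> i s * Delta \<alpha> i t"
  by (cases s; cases t) (simp add: Delta_X_def power_add prod.distrib mult_ac)

lemma Delta_Xj:
  "Delta \<alpha> i (Xpow (axis j 1)) =
     tensor (vec1 (Xpow (axis j 1))) 1 + tensor 1 (vec1 (axis j 1, {#}))"
proof -
  have "(\<Prod>j'\<in>UNIV. f j' ^ ((axis j 1 :: nat ^ _) $ j')) = f j" for f :: "_ \<Rightarrow> ('c::finite tree \<times> 'c plus_mon) \<Rightarrow>\<^sub>0 real"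
    by (simp add: axis_def if_distrib[of "\<lambda>n. _ ^ n"] prod.delta cong: if_cong)
  then show ?thesis
    by (simp add: Xpow_def Delta_X_def tensor_def)
qed

lemma Delta_noise: "e \<noteq> Kern \<Longrightarrow> Delta \<alpha> i (noise e) = tensor (vec1 (noise e)) 1"
  by (simp add: noise_def Delta_X_def tensor_def)

lemma Delta_plant:
  "Delta \<alpha> i (plant a t) =
     lin_ext (\<lambda>(s, w). vec1 (plant a s, w)) (Delta \<alpha> i t) +
     (\<Sum>(l, m) \<in> {(l, m). real (sdeg (l + m)) < deg \<alpha> i (plant a t)}.
        tensor (Poly_Mapping.single (Xpow l) (1 / mfact l))
               (Poly_Mapping.single (m, {#}) (1 / mfact m) * Iplus \<alpha> i (a + l + m) t))"
  by (simp add: plant_def Delta_X_def del: deg.simps)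

lemma D_Xi_X: "D_Xi (Xpow k) = 0"
  by (simp add: Xpow_def)

lemma D_Xi_noise: "D_Xi (noise Xi0) = vec1 (noise Xi1)"
  by (simp add: noise_def zero_tree_def[symmetric])

lemma D_Xi_plant: "D_Xi (plant a t) = lin_ext (\<lambda>s. vec1 (plant a s)) (D_Xi t)"
  by (simp add: plant_def zero_tree_def[symmetric])

lemma D_Xi_Leibniz:
  fixes s t :: "'a::finite tree"
  shows "D_Xi (s + t) = D_Xi s * vec1 t + vec1 s * D_Xi t"
proof (cases s; cases t)
  fix k l M N
  assume s: "s = Node k M" and t: "t = Node l N"
  define E :: "(etype \<times> 'a mi) \<times> 'a tree \<Rightarrow> 'a tree \<Rightarrow>\<^sub>0 real" where
    "E = (\<lambda>(e, t). case fst e of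
        Kern \<Rightarrow> lin_ext (\<lambda>s. vec1 (plant (snd e) s)) (D_Xi t)
      | Xi0 \<Rightarrow> vec1 (Node 0 {#((Xi1, snd e), t)#})
      | Xi1 \<Rightarrow> 0)"
  have D: "D_Xi (Node k M) = (\<Sum>c\<in>#M. vec1 (Node k (M - {#c#})) * E c)" for k M
    by (auto simp: E_def intro!: arg_cong[where f = sum_mset] image_mset_cong)
  have "(\<Sum>c\<in>#M. vec1 (Node (k + l) (M + N - {#c#})) * E c) = D_Xi s * vec1 t"
  proof -
    have "vec1 (Node (k + l) (M + N - {#c#})) * E c = vec1 (Node k (M - {#c#})) * E c * vec1 t"
      if "c \<in># M" for c
    proof -
      have "Node (k + l) (M + N - {#c#}) = Node k (M - {#c#}) + t"
        using that by (simp add: t)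
      then have "vec1 (Node (k + l) (M + N - {#c#})) = vec1 (Node k (M - {#c#})) * vec1 t"
        by (simp add: mult_single)
      then show ?thesis by (simp add: mult_ac)
    qed
    then show ?thesis
      by (simp add: s D sum_mset_distrib_right cong: image_mset_cong del: D_Xi.simps)
  qed
  moreover have "(\<Sum>c\<in>#N. vec1 (Node (k + l) (M + N - {#c#})) * E c) = vec1 s * D_Xi t"
  proof -
    have "vec1 (Node (k + l) (M + N - {#c#})) * E c = vec1 s * (vec1 (Node l (N - {#c#})) * E c)"
      if "c \<in># N" for c
    proof -
      have "Node (k + l) (M + N - {#c#}) = s + Node l (N - {#c#})"
        using that by (simp add: s)
      then have "vec1 (Node (k + l) (M + N - {#c#})) = vec1 s * vec1 (Node l (N - {#c#}))"
        by (simp add: mult_single)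
      then show ?thesis by (simp add: mult_ac)
    qed
    then show ?thesis
      by (simp add: t D sum_mset_distrib_left cong: image_mset_cong del: D_Xi.simps)
  qed
  ultimately show ?thesis
    by (simp add: s t D del: D_Xi.simps)
qed

end

theory Submission
  imports Defs
begin

text \<open>By the Leibniz rules for \<open>\<delta>\<close> and \<open>D\<^sub>\<Xi>\<close>, the identity for \<open>\<Pi>\<close>-hat passes to tree products. For a
  planted tree, \<open>\<Pi>\<close>-hat is a fixed continuous linear operator on \<open>C\<^sup>\<infinity>\<close> applied to \<open>\<Pi> \<tau>\<close>, the
  convolution with the integrable kernel \<open>K\<close> minus a Taylor jet; it commutes with \<open>\<delta>\<close>, and
  \<open>R D\<^sub>\<Xi> = D\<^sub>\<Xi> R\<close> reduces the claim to the trees in \<open>R \<tau>\<close>, which are \<open>\<tau>\<close> itself or have fewer noises.\<close>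


section \<open>Smooth functions\<close>

text \<open>Two obstacles shape the proof. The operator of a planted tree can be exchanged with
  linear combinations only on smooth functions, and \<open>D_Xi\<close> leads out of
  \<open>T0\<close>, since its terms contain \<open>Xi1\<close>. The second induction must also
  carry independence of the second noise slot: differentiating a product leaves one factor evaluated
  at (\<xi>, \<eta>), the Leibniz rule for \<open>D_Xi\<close> leaves it at (\<xi>, h), and the
  absence of \<open>Xi1\<close> in \<open>T0\<close> identifies the two. The singularity of D^a K
  never enters, because \<open>Dconv\<close> puts all derivatives on the smooth argument; the price
  is a higher order and a larger ball in the seminorms.\<close>

lemma partials_Nil [simp]: "partials [] f = f"
  by (simp add: partials_def)

lemma partials_Cons [simp]: "partials (j # js) f = partial j (partials js f)"
  by (simp add: partials_def)

lemma partials_append: "partials (is @ js) f = partials is (partials js f)"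
  by (simp add: partials_def)

lemma smoothD: "smooth f \<Longrightarrow> partials js f differentiable (at x)"
  by (simp add: smooth_on_def)

lemma smooth_differentiable: "smooth f \<Longrightarrow> f differentiable (at x)"
  using smoothD[of f "[]"] by simp

lemma smooth_continuous_on: "smooth f \<Longrightarrow> continuous_on S f"
  by (simp add: continuous_at_imp_continuous_on differentiable_imp_continuous_within smooth_differentiable)

lemma smooth_partials: "smooth f \<Longrightarrow> smooth (partials js f)"
  by (simp add: smooth_on_def flip: partials_append)

lemma smooth_partial: "smooth f \<Longrightarrow> smooth (partial j f)"
  using smooth_partials[of f "[j]"] by simp

text \<open>All iterated partials of a member of \<open>S\<close> stay in \<open>S\<close>, so a
  smoothness proof amounts to exhibiting a class of differentiable functions closed under
  \<open>partial\<close>.\<close>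

lemma smooth_coinduct:
  assumes "f \<in> S"
    and "\<And>g x. g \<in> S \<Longrightarrow> g differentiable (at x)"
    and "\<And>g j. g \<in> S \<Longrightarrow> partial j g \<in> S"
  shows "smooth f"
proof -
  have "partials js f \<in> S" for js
    by (induction js) (auto simp: assms)
  then show ?thesis
    by (auto simp: smooth_on_def assms)
qed

lemma partial_eq:
  assumes "\<And>x. (f has_derivative f' x) (at x)"
  shows "partial j f = (\<lambda>x. f' x (axis j 1))"
  unfolding partial_def using frechet_derivative_at[OF assms] by metis

lemma partial_const [simp]: "partial j (\<lambda>x. c) = (\<lambda>x. 0)"
  by (rule partial_eq) simp

lemma partial_add:
  assumes "\<And>x. f differentiable (at x)" and "\<And>x. g differentiable (at x)"
  shows "partial j (\<lambda>x. f x + g x) = (\<lambda>x. partial j f x + partial j g x)"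
proof -
  have "((\<lambda>x. f x + g x) has_derivative
      (\<lambda>v. frechet_derivative f (at x) v + frechet_derivative g (at x) v)) (at x)" for x
    using assms by (intro has_derivative_add) (simp_all add: frechet_derivative_works[symmetric])
  from partial_eq[OF this] show ?thesis
    by (simp add: partial_def)
qed

lemma partial_mult:
  assumes "\<And>x. f differentiable (at x)" and "\<And>x. g differentiable (at x)"
  shows "partial j (\<lambda>x. f x * g x) = (\<lambda>x. f x * partial j g x + partial j f x * g x)"
proof -
  have "((\<lambda>x. f x * g x) has_derivative
      (\<lambda>v. f x * frechet_derivative g (at x) v + frechet_derivative f (at x) v * g x)) (at x)" for x
    using assms by (intro has_derivative_mult) (simp_all add: frechet_derivative_works[symmetric])
  from partial_eq[OF this] show ?thesis
    by (simp add: partial_def)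
qed

text \<open>Products alone are not stable under \<open>partial\<close>, but their sums are, so \<open>smooth_coinduct\<close> applies.\<close>

inductive_set prod_sums :: "(real ^ 'n::finite \<Rightarrow> real) set" where
  mult: "smooth f \<Longrightarrow> smooth g \<Longrightarrow> (\<lambda>x. f x * g x) \<in> prod_sums"
| add: "u \<in> prod_sums \<Longrightarrow> v \<in> prod_sums \<Longrightarrow> (\<lambda>x. u x + v x) \<in> prod_sums"

lemma smooth_prod_sums:
  assumes "u \<in> prod_sums"
  shows "smooth u"
proof (rule smooth_coinduct[OF assms])
  have diff: "(\<forall>x. u differentiable (at x)) \<and> (\<forall>j. partial j u \<in> prod_sums)"
    if "u \<in> prod_sums" for u :: "real ^ 'n::finite \<Rightarrow> real"
    using that
  proof induction
    case (mult f g)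
    then show ?case
      by (auto simp: partial_mult smooth_differentiable smooth_partial
          intro!: differentiable_mult prod_sums.intros)
  next
    case (add u v)
    then show ?case
      by (auto simp: partial_add intro!: differentiable_add prod_sums.intros)
  qed
  show "g differentiable (at x)" if "g \<in> prod_sums" for g and x :: "real ^ 'a::finite"
    using diff[OF that] by blast
  show "partial j g \<in> prod_sums" if "g \<in> prod_sums" for g and j :: 'a
    using diff[OF that] by blast
qed

lemma smooth_const [simp]: "smooth (\<lambda>x. c)"
  by (rule smooth_coinduct[where S = "range (\<lambda>c x. c)"]) auto

lemma smooth_mult: "smooth f \<Longrightarrow> smooth g \<Longrightarrow> smooth (\<lambda>x. f x * g x)"
  by (rule smooth_prod_sums[OF prod_sums.mult])

text \<open>Sums are already in \<open>prod_sums\<close>: f + g = f * 1 + g * 1.\<close>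

lemma smooth_add: "smooth f \<Longrightarrow> smooth g \<Longrightarrow> smooth (\<lambda>x. f x + g x)"
  using smooth_prod_sums[OF prod_sums.add[OF prod_sums.mult prod_sums.mult], of f "\<lambda>x. 1" g "\<lambda>x. 1"]
  by simp

lemma smooth_cmult: "smooth f \<Longrightarrow> smooth (\<lambda>x. c * f x)"
  by (simp add: smooth_mult)

lemma smooth_diff: "smooth f \<Longrightarrow> smooth g \<Longrightarrow> smooth (\<lambda>x. f x - g x)"
  using smooth_add[OF _ smooth_cmult[of g "-1"]] by simp

lemma smooth_sum: "(\<And>i. i \<in> I \<Longrightarrow> smooth (f i)) \<Longrightarrow> smooth (\<lambda>x. \<Sum>i\<in>I. f i x)"
  by (induction I rule: infinite_finite_induct) (auto intro: smooth_add)

lemma smooth_prod: "(\<And>i. i \<in> I \<Longrightarrow> smooth (f i)) \<Longrightarrow> smooth (\<lambda>x. \<Prod>i\<in>I. f i x)"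
  by (induction I rule: infinite_finite_induct) (auto intro: smooth_mult)

lemma smooth_power: "smooth f \<Longrightarrow> smooth (\<lambda>x. f x ^ n)"
  by (induction n) (auto intro: smooth_mult)

text \<open>Partial derivatives of a coordinate are constants, so the coordinate together with all
  constants is an invariant class.\<close>

lemma smooth_nth: "smooth (\<lambda>x. x $ i)"
proof (rule smooth_coinduct[where S = "insert (\<lambda>x. x $ i) (range (\<lambda>c x. c))"])
  have *: "((\<lambda>x. x $ i) has_derivative (\<lambda>x. x $ i)) (at x)" for x :: "real ^ 'a"
    by (intro bounded_linear_imp_has_derivative bounded_linear_vec_nth)
  show "partial j g \<in> insert (\<lambda>x. x $ i) (range (\<lambda>c x. c))"
    if "g \<in> insert (\<lambda>x. x $ i) (range (\<lambda>c x. c))" for g :: "real ^ 'a \<Rightarrow> real" and j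
    using that by (auto simp: partial_eq[OF *])
  show "g differentiable (at x)" if "g \<in> insert (\<lambda>x. x $ i) (range (\<lambda>c x. c))"
    for g :: "real ^ 'a \<Rightarrow> real" and x
    using that differentiableI[OF *] by auto
qed simp

lemma smooth_mpow: "smooth (\<lambda>y. mpow (y - x) k)"
  unfolding mpow_def by (intro smooth_prod smooth_power) (simp add: smooth_diff smooth_nth)

lemma partials_add:
  assumes "smooth f" and "smooth g"
  shows "partials js (\<lambda>x. f x + g x) = (\<lambda>x. partials js f x + partials js g x)"
  by (induction js) (simp_all add: partial_add smoothD assms)

lemma partials_cmult:
  assumes "smooth f"
  shows "partials js (\<lambda>x. c * f x) = (\<lambda>x. c * partials js f x)"
  by (induction js) (simp_all add: partial_mult smoothD assms)

lemma partials_const: "partials js (\<lambda>y. c) = (\<lambda>y. if js = [] then c else 0)"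
  by (induction js) auto


section \<open>Seminorms\<close>

text \<open>A real \<open>SUP\<close> says nothing about an unbounded set, so every upper estimate
  by \<open>cinf_norm\<close> rests on this. There are finitely many words of length at most n, and
  each gives a continuous function on a compact ball.\<close>

lemma cinf_norm_bdd:
  assumes "smooth f"
  shows "bdd_above ((\<lambda>(js, x). \<bar>partials js f x\<bar>) ` ({js. length js \<le> n} \<times> cball 0 (real n)))"
proof -
  have fin: "finite {js :: 'a list. length js \<le> n}"
    using finite_lists_length_le[of "UNIV :: 'a set" n] by simp
  have "bdd_above ((\<lambda>x. \<bar>partials js f x\<bar>) ` cball 0 (real n))" for js
    by (intro bounded_imp_bdd_above compact_imp_bounded compact_continuous_image
        continuous_intros compact_cball smooth_continuous_on smooth_partials assms)
  then have "bdd_above (\<Union>js\<in>{js. length js \<le> n}. (\<lambda>x. \<bar>partials js f x\<bar>) ` cball 0 (real n))"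
    by (simp add: fin)
  moreover have "(\<lambda>(js, x). \<bar>partials js f x\<bar>) ` ({js. length js \<le> n} \<times> cball 0 (real n)) =
      (\<Union>js\<in>{js. length js \<le> n}. (\<lambda>x. \<bar>partials js f x\<bar>) ` cball 0 (real n))"
    by force
  ultimately show ?thesis by simp
qed

lemma cinf_norm_upper:
  assumes "smooth f" and "length js \<le> n" and "norm x \<le> real n"
  shows "\<bar>partials js f x\<bar> \<le> cinf_norm n f"
  unfolding cinf_norm_def
  by (rule cSUP_upper2[OF cinf_norm_bdd[OF assms(1)], where x = "(js, x)"]) (use assms in auto)

lemma cinf_norm_least:
  assumes "\<And>js x. length js \<le> n \<Longrightarrow> norm x \<le> real n \<Longrightarrow> \<bar>partials js f x\<bar> \<le> B"
  shows "cinf_norm n f \<le> B"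
  unfolding cinf_norm_def
proof (rule cSUP_least)
  have "([], 0) \<in> {js. length js \<le> n} \<times> cball 0 (real n)" by simp
  then show "{js. length js \<le> n} \<times> cball 0 (real n) \<noteq> {}" by blast
qed (use assms in auto)

lemma cinf_norm_nonneg: "smooth f \<Longrightarrow> 0 \<le> cinf_norm n f"
  using cinf_norm_upper[of f "[]" n 0] by simp

lemma cinf_norm_mono: "smooth f \<Longrightarrow> m \<le> n \<Longrightarrow> cinf_norm m f \<le> cinf_norm n f"
  by (intro cinf_norm_least cinf_norm_upper) auto

lemma cinf_norm_add:
  assumes "smooth f" and "smooth g"
  shows "cinf_norm n (\<lambda>x. f x + g x) \<le> cinf_norm n f + cinf_norm n g"
  by (intro cinf_norm_least)
     (simp add: partials_add assms abs_triangle_ineq[THEN order_trans] add_mono cinf_norm_upper)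

text \<open>The Leibniz rule produces 2 ^ \<open>length js\<close> terms, each at most A * B. The
  induction peels off the last letter of the word, which acts first: one application of the product
  rule then leaves two products with the shorter word \<open>js\<close>, covered by the hypothesis
  for arbitrary factors.\<close>

lemma partials_mult_bound:
  assumes "smooth f" and "smooth g"
    and "\<And>is. length is \<le> length js \<Longrightarrow> \<bar>partials is f x\<bar> \<le> A"
    and "\<And>is. length is \<le> length js \<Longrightarrow> \<bar>partials is g x\<bar> \<le> B"
  shows "\<bar>partials js (\<lambda>x. f x * g x) x\<bar> \<le> 2 ^ length js * (A * B)"
  using assms
proof (induction js arbitrary: f g rule: rev_induct)
  case Nil
  then have "\<bar>f x\<bar> \<le> A" "\<bar>g x\<bar> \<le> B"
    using Nil(3)[of "[]"] Nil(4)[of "[]"] by auto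
  moreover from this have "0 \<le> A" by linarith
  ultimately show ?case
    by (simp add: abs_mult mult_mono)
next
  case (snoc j js)
  \<comment> \<open>A word applied to \<open>partial j h\<close> is a word one letter longer applied
    to \<open>h\<close>, so the bounds A and B pass to the differentiated factors.\<close>
  have p: "\<bar>partials is (partial j h) x\<bar> \<le> C"
    if "length is \<le> length js" "\<And>is. length is \<le> Suc (length js) \<Longrightarrow> \<bar>partials is h x\<bar> \<le> C" for h C "is"
    using that(2)[of "is @ [j]"] that(1) by (simp add: partials_append)
  have "\<bar>partials js (\<lambda>x. f x * partial j g x) x\<bar> \<le> 2 ^ length js * (A * B)"
    using snoc.prems by (intro snoc.IH p) (auto simp: smooth_partial)
  moreover have "\<bar>partials js (\<lambda>x. partial j f x * g x) x\<bar> \<le> 2 ^ length js * (A * B)"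
    using snoc.prems by (intro snoc.IH p) (auto simp: smooth_partial)
  moreover have "partials (js @ [j]) (\<lambda>x. f x * g x) x =
      partials js (\<lambda>x. f x * partial j g x) x + partials js (\<lambda>x. partial j f x * g x) x"
    using snoc.prems(1,2)
    by (simp add: partials_append partial_mult partials_add smooth_differentiable smooth_partial smooth_mult)
  ultimately show ?case
    by simp
qed

lemma cinf_norm_mult:
  assumes "smooth f" and "smooth g"
  shows "cinf_norm n (\<lambda>x. f x * g x) \<le> 2 ^ n * (cinf_norm n f * cinf_norm n g)"
proof (rule cinf_norm_least)
  fix js :: "'a list" and x :: "real ^ 'a"
  assume "length js \<le> n" "norm x \<le> real n"
  then have "\<bar>partials js (\<lambda>x. f x * g x) x\<bar> \<le> 2 ^ length js * (cinf_norm n f * cinf_norm n g)"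
    by (intro partials_mult_bound assms cinf_norm_upper) auto
  also have "\<dots> \<le> 2 ^ n * (cinf_norm n f * cinf_norm n g)"
    using \<open>length js \<le> n\<close> by (intro mult_right_mono power_increasing mult_nonneg_nonneg cinf_norm_nonneg assms) auto
  finally show "\<bar>partials js (\<lambda>x. f x * g x) x\<bar> \<le> \<dots>" .
qed

lemma cinf_norm_zero: "cinf_norm n (\<lambda>y. 0) \<le> 0"
  by (rule cinf_norm_least) (simp add: partials_const)


section \<open>Continuous linear maps and Frechet derivatives\<close>

text \<open>These are the conditions that \<open>has_cinf_derivative\<close> puts on
  \<open>L\<close>, isolated so that they can be composed. They speak of smooth arguments only: on
  other functions the integrals and derivatives inside the operators may take arbitrary default
  values.\<close>

definition cinf_linear :: "((real ^ 'n::finite \<Rightarrow> real) \<Rightarrow> (real ^ 'n \<Rightarrow> real)) \<Rightarrow> bool" where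
  "cinf_linear A \<longleftrightarrow>
     (\<forall>h. smooth h \<longrightarrow> smooth (A h)) \<and>
     (\<forall>h g. smooth h \<longrightarrow> smooth g \<longrightarrow> A (\<lambda>y. h y + g y) = (\<lambda>y. A h y + A g y)) \<and>
     (\<forall>c h. smooth h \<longrightarrow> A (\<lambda>y. c * h y) = (\<lambda>y. c * A h y)) \<and>
     (\<forall>n. \<exists>m C. \<forall>h. smooth h \<longrightarrow> cinf_norm n (A h) \<le> C * cinf_norm m h)"

lemma cinf_linearI:
  assumes "\<And>h. smooth h \<Longrightarrow> smooth (A h)"
    and "\<And>h g. smooth h \<Longrightarrow> smooth g \<Longrightarrow> A (\<lambda>y. h y + g y) = (\<lambda>y. A h y + A g y)"
    and "\<And>c h. smooth h \<Longrightarrow> A (\<lambda>y. c * h y) = (\<lambda>y. c * A h y)"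
    and "\<And>n. \<exists>m C. \<forall>h. smooth h \<longrightarrow> cinf_norm n (A h) \<le> C * cinf_norm m h"
  shows "cinf_linear A"
  using assms unfolding cinf_linear_def by blast

lemma cinf_linear_smooth: "cinf_linear A \<Longrightarrow> smooth h \<Longrightarrow> smooth (A h)"
  by (simp add: cinf_linear_def)

lemma cinf_linear_add:
  "cinf_linear A \<Longrightarrow> smooth h \<Longrightarrow> smooth g \<Longrightarrow> A (\<lambda>y. h y + g y) = (\<lambda>y. A h y + A g y)"
  by (simp add: cinf_linear_def)

lemma cinf_linear_cmult:
  "cinf_linear A \<Longrightarrow> smooth h \<Longrightarrow> A (\<lambda>y. c * h y) = (\<lambda>y. c * A h y)"
  by (simp add: cinf_linear_def)

lemma cinf_linear_diff:
  "cinf_linear A \<Longrightarrow> smooth h \<Longrightarrow> smooth g \<Longrightarrow> A (\<lambda>y. h y - g y) = (\<lambda>y. A h y - A g y)"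
  using cinf_linear_add[of A h "\<lambda>y. - 1 * g y"] cinf_linear_cmult[of A g "-1"] smooth_cmult[of g "-1"]
  by simp

lemma cinf_linear_sum:
  assumes "cinf_linear A" and "\<And>i. i \<in> I \<Longrightarrow> smooth (f i)"
  shows "A (\<lambda>y. \<Sum>i\<in>I. c i * f i y) = (\<lambda>y. \<Sum>i\<in>I. c i * A (f i) y)"
  using assms(2)
proof (induction I rule: infinite_finite_induct)
  case (insert i I)
  then show ?case
    by (simp add: cinf_linear_add[OF assms(1)] cinf_linear_cmult[OF assms(1)] smooth_cmult smooth_sum)
qed (use cinf_linear_cmult[OF assms(1), of "\<lambda>x. 0" 0] in auto)

text \<open>Normal form of continuity: a non-negative constant, and freedom to raise the seminorm,
  so that estimates for several operators can be brought to one common index.\<close>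

lemma cinf_linear_bound:
  assumes "cinf_linear A"
  shows "\<exists>m C. 0 \<le> C \<and> (\<forall>h m'. smooth h \<longrightarrow> m \<le> m' \<longrightarrow> cinf_norm n (A h) \<le> C * cinf_norm m' h)"
proof -
  obtain m C where *: "\<And>h. smooth h \<Longrightarrow> cinf_norm n (A h) \<le> C * cinf_norm m h"
    using assms unfolding cinf_linear_def by blast
  have "cinf_norm n (A h) \<le> \<bar>C\<bar> * cinf_norm m' h" if "smooth h" "m \<le> m'" for h m'
  proof -
    have "C * cinf_norm m h \<le> \<bar>C\<bar> * cinf_norm m' h"
      using that by (intro mult_mono) (auto simp: cinf_norm_mono cinf_norm_nonneg)
    with *[OF that(1)] show ?thesis by linarith
  qed
  then show ?thesis
    by (intro exI[of _ m] exI[of _ "\<bar>C\<bar>"]) auto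
qed

lemma cinf_linear_ident: "cinf_linear (\<lambda>h. h)"
proof (rule cinf_linearI)
  show "\<exists>m C. \<forall>h. smooth h \<longrightarrow> cinf_norm n h \<le> C * cinf_norm m h" for n
    by (intro exI[of _ n] exI[of _ 1]) simp
qed auto

lemma cinf_linear_zero: "cinf_linear (\<lambda>h y. 0)"
proof (rule cinf_linearI)
  show "\<exists>m C. \<forall>h :: real ^ 'a \<Rightarrow> real. smooth h \<longrightarrow> cinf_norm n (\<lambda>y :: real ^ 'a. 0) \<le> C * cinf_norm m h" for n
    by (intro exI[of _ 0]) (simp add: cinf_norm_zero)
qed auto

lemma cinf_linear_plus:
  assumes A: "cinf_linear A" and B: "cinf_linear B"
  shows "cinf_linear (\<lambda>h y. A h y + B h y)"
proof (rule cinf_linearI)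
  fix n
  obtain m C where mC: "\<And>h m'. smooth h \<Longrightarrow> m \<le> m' \<Longrightarrow> cinf_norm n (A h) \<le> C * cinf_norm m' h"
    using cinf_linear_bound[OF A, of n] by blast
  obtain l D where lD: "\<And>h m'. smooth h \<Longrightarrow> l \<le> m' \<Longrightarrow> cinf_norm n (B h) \<le> D * cinf_norm m' h"
    using cinf_linear_bound[OF B, of n] by blast
  have "cinf_norm n (\<lambda>y. A h y + B h y) \<le> (C + D) * cinf_norm (max m l) h" if "smooth h" for h
    using cinf_norm_add[OF cinf_linear_smooth[OF A that] cinf_linear_smooth[OF B that], of n]
      mC[OF that, of "max m l"] lD[OF that, of "max m l"] by (simp add: algebra_simps)
  then show "\<exists>m C. \<forall>h. smooth h \<longrightarrow> cinf_norm n (\<lambda>y. A h y + B h y) \<le> C * cinf_norm m h"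
    by blast
qed (auto simp: cinf_linear_add cinf_linear_cmult cinf_linear_smooth A B smooth_add algebra_simps)

lemma cinf_linear_compose:
  assumes A: "cinf_linear A" and B: "cinf_linear B"
  shows "cinf_linear (\<lambda>h. A (B h))"
proof (rule cinf_linearI)
  fix n
  obtain m C where C: "0 \<le> C"
    and mC: "\<And>h m'. smooth h \<Longrightarrow> m \<le> m' \<Longrightarrow> cinf_norm n (A h) \<le> C * cinf_norm m' h"
    using cinf_linear_bound[OF A, of n] by blast
  obtain l D where lD: "\<And>h m'. smooth h \<Longrightarrow> l \<le> m' \<Longrightarrow> cinf_norm m (B h) \<le> D * cinf_norm m' h"
    using cinf_linear_bound[OF B, of m] by blast
  have "cinf_norm n (A (B h)) \<le> (C * D) * cinf_norm l h" if "smooth h" for h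
    using mC[OF cinf_linear_smooth[OF B that] order_refl] mult_left_mono[OF lD[OF that order_refl] C]
    by (simp add: mult.assoc)
  then show "\<exists>m C. \<forall>h. smooth h \<longrightarrow> cinf_norm n (A (B h)) \<le> C * cinf_norm m h"
    by blast
qed (auto simp: cinf_linear_add cinf_linear_cmult cinf_linear_smooth A B)

lemma cinf_linear_mult:
  assumes g: "smooth g"
  shows "cinf_linear (\<lambda>h y. g y * h y)"
proof (rule cinf_linearI)
  fix n
  have "cinf_norm n (\<lambda>y. g y * h y) \<le> (2 ^ n * cinf_norm n g) * cinf_norm n h" if "smooth h" for h
    using cinf_norm_mult[OF g that] by (simp add: mult.assoc)
  then show "\<exists>m C. \<forall>h. smooth h \<longrightarrow> cinf_norm n (\<lambda>y. g y * h y) \<le> C * cinf_norm m h"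
    by blast
qed (auto simp: smooth_mult g algebra_simps)

lemma cinf_linear_partials: "cinf_linear (partials js)"
proof (rule cinf_linearI)
  fix n
  have "cinf_norm n (partials js h) \<le> 1 * cinf_norm (n + length js) h" if "smooth h" for h
    using that by (auto intro!: cinf_norm_least cinf_norm_upper simp flip: partials_append)
  then show "\<exists>m C. \<forall>h. smooth h \<longrightarrow> cinf_norm n (partials js h) \<le> C * cinf_norm m h"
    by blast
qed (auto simp: partials_add partials_cmult smooth_partials)

text \<open>Needed for the Taylor coefficients at x, read as constant functions. The index only has
  to be large enough for the ball to contain x; only the empty word contributes for a
  constant.\<close>

lemma cinf_linear_eval: "cinf_linear (\<lambda>h y. h x)"
proof (rule cinf_linearI)
  fix n
  have "cinf_norm n (\<lambda>y. h x) \<le> 1 * cinf_norm (nat \<lceil>norm x\<rceil>) h" if "smooth h" for h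
  proof -
    have "\<bar>h x\<bar> \<le> cinf_norm (nat \<lceil>norm x\<rceil>) h"
      using cinf_norm_upper[OF that, of "[]" "nat \<lceil>norm x\<rceil>" x] by (simp add: real_nat_ceiling_ge)
    moreover have "0 \<le> cinf_norm (nat \<lceil>norm x\<rceil>) h"
      by (rule cinf_norm_nonneg[OF that])
    ultimately show ?thesis
      by (intro cinf_norm_least) (auto simp: partials_const)
  qed
  then show "\<exists>m C. \<forall>h. smooth h \<longrightarrow> cinf_norm n (\<lambda>y. h x) \<le> C * cinf_norm m h"
    by blast
qed auto

lemma cinf_linear_Sum:
  assumes "\<And>i. i \<in> I \<Longrightarrow> cinf_linear (A i)"
  shows "cinf_linear (\<lambda>h y. \<Sum>i\<in>I. A i h y)"
  using assms by (induction I rule: infinite_finite_induct) (auto intro: cinf_linear_zero cinf_linear_plus)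

section \<open>Calculus of the Frechet derivative: linear images, sums and products\<close>

lemma has_cinf_derivative_iff:
  "has_cinf_derivative \<Phi> L \<xi> \<longleftrightarrow> (\<forall>h. smooth h \<longrightarrow> smooth (\<Phi> h)) \<and> cinf_linear L \<and>
     (\<forall>n. \<exists>m. \<forall>\<epsilon>>0. \<exists>r>0. \<forall>h. smooth h \<longrightarrow> cinf_norm m h < r \<longrightarrow>
        cinf_norm n (\<lambda>y. \<Phi> (\<lambda>z. \<xi> z + h z) y - \<Phi> \<xi> y - L h y) \<le> \<epsilon> * cinf_norm m h)"
  unfolding has_cinf_derivative_def cinf_linear_def by blast

lemma has_cinf_derivativeI:
  assumes "\<And>h. smooth h \<Longrightarrow> smooth (\<Phi> h)" and "cinf_linear L"
    and "\<And>n. \<exists>m. \<forall>\<epsilon>>0. \<exists>r>0. \<forall>h. smooth h \<longrightarrow> cinf_norm m h < r \<longrightarrow>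
        cinf_norm n (\<lambda>y. \<Phi> (\<lambda>z. \<xi> z + h z) y - \<Phi> \<xi> y - L h y) \<le> \<epsilon> * cinf_norm m h"
  shows "has_cinf_derivative \<Phi> L \<xi>"
  using assms unfolding has_cinf_derivative_iff by blast

lemma has_cinf_derivative_smooth: "has_cinf_derivative \<Phi> L \<xi> \<Longrightarrow> smooth h \<Longrightarrow> smooth (\<Phi> h)"
  by (simp add: has_cinf_derivative_iff)

lemma has_cinf_derivative_linear: "has_cinf_derivative \<Phi> L \<xi> \<Longrightarrow> cinf_linear L"
  by (simp add: has_cinf_derivative_iff)

text \<open>The definition supplies one seminorm, chosen before \<epsilon>. A larger one is also
  admissible, as it shrinks the set of directions and weakens the bound; this allows the remainders
  of two maps to be measured by the same seminorm.\<close>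

lemma has_cinf_derivative_remainder:
  assumes "has_cinf_derivative \<Phi> L \<xi>"
  shows "\<exists>m. \<forall>\<epsilon> m'. 0 < \<epsilon> \<longrightarrow> m \<le> m' \<longrightarrow> (\<exists>r>0. \<forall>h. smooth h \<longrightarrow> cinf_norm m' h < r \<longrightarrow>
        cinf_norm n (\<lambda>y. \<Phi> (\<lambda>z. \<xi> z + h z) y - \<Phi> \<xi> y - L h y) \<le> \<epsilon> * cinf_norm m' h)"
proof -
  obtain m where m: "\<And>\<epsilon>. 0 < \<epsilon> \<Longrightarrow> \<exists>r>0. \<forall>h. smooth h \<longrightarrow> cinf_norm m h < r \<longrightarrow>
        cinf_norm n (\<lambda>y. \<Phi> (\<lambda>z. \<xi> z + h z) y - \<Phi> \<xi> y - L h y) \<le> \<epsilon> * cinf_norm m h"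
    using assms unfolding has_cinf_derivative_iff by blast
  show ?thesis
  proof (intro exI[of _ m] allI impI)
    fix \<epsilon> :: real and m' assume "0 < \<epsilon>" "m \<le> m'"
    then obtain r where "r > 0" and r: "\<And>h. smooth h \<Longrightarrow> cinf_norm m h < r \<Longrightarrow>
        cinf_norm n (\<lambda>y. \<Phi> (\<lambda>z. \<xi> z + h z) y - \<Phi> \<xi> y - L h y) \<le> \<epsilon> * cinf_norm m h"
      using m by blast
    have "cinf_norm n (\<lambda>y. \<Phi> (\<lambda>z. \<xi> z + h z) y - \<Phi> \<xi> y - L h y) \<le> \<epsilon> * cinf_norm m' h"
      if "smooth h" "cinf_norm m' h < r" for h
    proof -
      have "cinf_norm m h \<le> cinf_norm m' h"
        using \<open>m \<le> m'\<close> that by (intro cinf_norm_mono)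
      then have "\<epsilon> * cinf_norm m h \<le> \<epsilon> * cinf_norm m' h"
        using \<open>0 < \<epsilon>\<close> by simp
      with r[of h] that \<open>cinf_norm m h \<le> cinf_norm m' h\<close> show ?thesis by linarith
    qed
    with \<open>r > 0\<close> show "\<exists>r>0. \<forall>h. smooth h \<longrightarrow> cinf_norm m' h < r \<longrightarrow>
        cinf_norm n (\<lambda>y. \<Phi> (\<lambda>z. \<xi> z + h z) y - \<Phi> \<xi> y - L h y) \<le> \<epsilon> * cinf_norm m' h"
      by blast
  qed
qed

lemma has_cinf_derivative_const:
  assumes "smooth g"
  shows "has_cinf_derivative (\<lambda>\<zeta>. g) (\<lambda>h y. 0) \<xi>"
proof (rule has_cinf_derivativeI)
  fix n
  have "cinf_norm n (\<lambda>y :: real ^ 'a. 0) \<le> \<epsilon> * cinf_norm 0 h" if "0 < \<epsilon>" "smooth h" for \<epsilon> and h :: "real ^ 'a \<Rightarrow> real"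
    using that by (intro order_trans[OF cinf_norm_zero] mult_nonneg_nonneg cinf_norm_nonneg) auto
  then show "\<exists>m. \<forall>\<epsilon>>0. \<exists>r>0. \<forall>h :: real ^ 'a \<Rightarrow> real. smooth h \<longrightarrow> cinf_norm m h < r \<longrightarrow>
        cinf_norm n (\<lambda>y. g y - g y - 0) \<le> \<epsilon> * cinf_norm m h"
    by (intro exI[of _ "0 :: nat"] allI impI exI[of _ "1 :: real"]) auto
qed (use assms cinf_linear_zero in auto)

lemma has_cinf_derivative_ident: "has_cinf_derivative (\<lambda>\<zeta>. \<zeta>) (\<lambda>h. h) \<xi>"
proof (rule has_cinf_derivativeI)
  fix n
  have "cinf_norm n (\<lambda>y :: real ^ 'a. 0) \<le> \<epsilon> * cinf_norm 0 h" if "0 < \<epsilon>" "smooth h" for \<epsilon> and h :: "real ^ 'a \<Rightarrow> real"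
    using that by (intro order_trans[OF cinf_norm_zero] mult_nonneg_nonneg cinf_norm_nonneg) auto
  then show "\<exists>m. \<forall>\<epsilon>>0. \<exists>r>0. \<forall>h. smooth h \<longrightarrow> cinf_norm m h < r \<longrightarrow>
        cinf_norm n (\<lambda>y. \<xi> y + h y - \<xi> y - h y) \<le> \<epsilon> * cinf_norm m h"
    by (intro exI[of _ "0 :: nat"] allI impI exI[of _ "1 :: real"]) auto
qed (use cinf_linear_ident in auto)

text \<open>By linearity, the remainder of the composite is \<open>A\<close> applied to the
  remainder of \<open>\<Phi>\<close>, and continuity of \<open>A\<close> keeps it o(h).\<close>

lemma has_cinf_derivative_compose:
  assumes A: "cinf_linear A" and \<Phi>: "has_cinf_derivative \<Phi> L \<xi>" and \<xi>: "smooth \<xi>"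
  shows "has_cinf_derivative (\<lambda>\<zeta>. A (\<Phi> \<zeta>)) (\<lambda>h. A (L h)) \<xi>"
proof (rule has_cinf_derivativeI)
  note L = has_cinf_derivative_linear[OF \<Phi>]
  note smooths = has_cinf_derivative_smooth[OF \<Phi>] cinf_linear_smooth[OF L] \<xi> smooth_add smooth_diff
  show "smooth (A (\<Phi> h))" if "smooth h" for h
    using that by (intro cinf_linear_smooth[OF A] smooths)
  show "cinf_linear (\<lambda>h. A (L h))"
    by (rule cinf_linear_compose[OF A L])
  fix n
  obtain m C where C: "0 \<le> C"
    and mC: "\<And>h m'. smooth h \<Longrightarrow> m \<le> m' \<Longrightarrow> cinf_norm n (A h) \<le> C * cinf_norm m' h"
    using cinf_linear_bound[OF A, of n] by blast
  obtain l where l: "\<And>\<epsilon> m'. 0 < \<epsilon> \<Longrightarrow> l \<le> m' \<Longrightarrow> \<exists>r>0. \<forall>h. smooth h \<longrightarrow> cinf_norm m' h < r \<longrightarrow>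
        cinf_norm m (\<lambda>y. \<Phi> (\<lambda>z. \<xi> z + h z) y - \<Phi> \<xi> y - L h y) \<le> \<epsilon> * cinf_norm m' h"
    using has_cinf_derivative_remainder[OF \<Phi>, of m] by blast
  show "\<exists>m. \<forall>\<epsilon>>0. \<exists>r>0. \<forall>h. smooth h \<longrightarrow> cinf_norm m h < r \<longrightarrow>
      cinf_norm n (\<lambda>y. A (\<Phi> (\<lambda>z. \<xi> z + h z)) y - A (\<Phi> \<xi>) y - A (L h) y) \<le> \<epsilon> * cinf_norm m h"
  proof (intro exI[of _ l] allI impI)
    fix \<epsilon> :: real assume "0 < \<epsilon>"
    \<comment> \<open>The bound C of \<open>A\<close> may be 0, hence the division by C + 1.\<close>
    then have "0 < \<epsilon> / (C + 1)" using C by simp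
    from l[OF this order_refl] obtain r where "r > 0" and r: "\<And>h. smooth h \<Longrightarrow> cinf_norm l h < r \<Longrightarrow>
        cinf_norm m (\<lambda>y. \<Phi> (\<lambda>z. \<xi> z + h z) y - \<Phi> \<xi> y - L h y) \<le> \<epsilon> / (C + 1) * cinf_norm l h"
      by blast
    have "cinf_norm n (\<lambda>y. A (\<Phi> (\<lambda>z. \<xi> z + h z)) y - A (\<Phi> \<xi>) y - A (L h) y) \<le> \<epsilon> * cinf_norm l h"
      if h: "smooth h" and hr: "cinf_norm l h < r" for h
    proof -
      let ?\<rho> = "\<lambda>y. \<Phi> (\<lambda>z. \<xi> z + h z) y - \<Phi> \<xi> y - L h y"
      have "(\<lambda>y. A (\<Phi> (\<lambda>z. \<xi> z + h z)) y - A (\<Phi> \<xi>) y - A (L h) y) = A ?\<rho>"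
        using h by (simp add: cinf_linear_diff[OF A] smooths)
      moreover have "cinf_norm n (A ?\<rho>) \<le> C * cinf_norm m ?\<rho>"
        using h by (intro mC order_refl smooths)
      moreover have "C * cinf_norm m ?\<rho> \<le> C * (\<epsilon> / (C + 1) * cinf_norm l h)"
        by (intro mult_left_mono r h hr C)
      moreover have "C * (\<epsilon> / (C + 1) * cinf_norm l h) \<le> \<epsilon> * cinf_norm l h"
        using C \<open>0 < \<epsilon>\<close> mult_nonneg_nonneg[OF less_imp_le[OF \<open>0 < \<epsilon>\<close>] cinf_norm_nonneg[OF h, of l]]
        by (simp add: field_simps)
      ultimately show ?thesis by simp
    qed
    with \<open>r > 0\<close> show "\<exists>r>0. \<forall>h. smooth h \<longrightarrow> cinf_norm l h < r \<longrightarrow>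
      cinf_norm n (\<lambda>y. A (\<Phi> (\<lambda>z. \<xi> z + h z)) y - A (\<Phi> \<xi>) y - A (L h) y) \<le> \<epsilon> * cinf_norm l h"
      by blast
  qed
qed

lemma has_cinf_derivative_add:
  assumes \<Phi>: "has_cinf_derivative \<Phi> L \<xi>" and \<Psi>: "has_cinf_derivative \<Psi> M \<xi>" and \<xi>: "smooth \<xi>"
  shows "has_cinf_derivative (\<lambda>\<zeta> y. \<Phi> \<zeta> y + \<Psi> \<zeta> y) (\<lambda>h y. L h y + M h y) \<xi>"
proof (rule has_cinf_derivativeI)
  note L = has_cinf_derivative_linear[OF \<Phi>] and M = has_cinf_derivative_linear[OF \<Psi>]
  note smooths = has_cinf_derivative_smooth[OF \<Phi>] has_cinf_derivative_smooth[OF \<Psi>]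
    cinf_linear_smooth[OF L] cinf_linear_smooth[OF M] \<xi> smooth_add smooth_diff
  show "smooth (\<lambda>y. \<Phi> h y + \<Psi> h y)" if "smooth h" for h
    using that by (intro smooths)
  show "cinf_linear (\<lambda>h y. L h y + M h y)"
    by (rule cinf_linear_plus[OF L M])
  fix n
  obtain k where k: "\<And>\<epsilon> m'. 0 < \<epsilon> \<Longrightarrow> k \<le> m' \<Longrightarrow> \<exists>r>0. \<forall>h. smooth h \<longrightarrow> cinf_norm m' h < r \<longrightarrow>
        cinf_norm n (\<lambda>y. \<Phi> (\<lambda>z. \<xi> z + h z) y - \<Phi> \<xi> y - L h y) \<le> \<epsilon> * cinf_norm m' h"
    using has_cinf_derivative_remainder[OF \<Phi>, of n] by blast
  obtain l where l: "\<And>\<epsilon> m'. 0 < \<epsilon> \<Longrightarrow> l \<le> m' \<Longrightarrow> \<exists>r>0. \<forall>h. smooth h \<longrightarrow> cinf_norm m' h < r \<longrightarrow>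
        cinf_norm n (\<lambda>y. \<Psi> (\<lambda>z. \<xi> z + h z) y - \<Psi> \<xi> y - M h y) \<le> \<epsilon> * cinf_norm m' h"
    using has_cinf_derivative_remainder[OF \<Psi>, of n] by blast
  define m where "m = max k l"
  show "\<exists>m. \<forall>\<epsilon>>0. \<exists>r>0. \<forall>h. smooth h \<longrightarrow> cinf_norm m h < r \<longrightarrow>
      cinf_norm n (\<lambda>y. \<Phi> (\<lambda>z. \<xi> z + h z) y + \<Psi> (\<lambda>z. \<xi> z + h z) y - (\<Phi> \<xi> y + \<Psi> \<xi> y) - (L h y + M h y))
        \<le> \<epsilon> * cinf_norm m h"
  proof (intro exI[of _ m] allI impI)
    fix \<epsilon> :: real assume "0 < \<epsilon>"
    then have "0 < \<epsilon> / 2" by simp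
    from k[OF this, of m] obtain r where "r > 0" and r: "\<And>h. smooth h \<Longrightarrow> cinf_norm m h < r \<Longrightarrow>
        cinf_norm n (\<lambda>y. \<Phi> (\<lambda>z. \<xi> z + h z) y - \<Phi> \<xi> y - L h y) \<le> \<epsilon> / 2 * cinf_norm m h"
      unfolding m_def by auto
    from l[OF \<open>0 < \<epsilon> / 2\<close>, of m] obtain s where "s > 0" and s: "\<And>h. smooth h \<Longrightarrow> cinf_norm m h < s \<Longrightarrow>
        cinf_norm n (\<lambda>y. \<Psi> (\<lambda>z. \<xi> z + h z) y - \<Psi> \<xi> y - M h y) \<le> \<epsilon> / 2 * cinf_norm m h"
      unfolding m_def by auto
    have "cinf_norm n (\<lambda>y. \<Phi> (\<lambda>z. \<xi> z + h z) y + \<Psi> (\<lambda>z. \<xi> z + h z) y - (\<Phi> \<xi> y + \<Psi> \<xi> y) - (L h y + M h y))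
        \<le> \<epsilon> * cinf_norm m h"
      if h: "smooth h" and hr: "cinf_norm m h < min r s" for h
    proof -
      let ?\<rho> = "\<lambda>y. \<Phi> (\<lambda>z. \<xi> z + h z) y - \<Phi> \<xi> y - L h y"
      let ?\<sigma> = "\<lambda>y. \<Psi> (\<lambda>z. \<xi> z + h z) y - \<Psi> \<xi> y - M h y"
      have "(\<lambda>y. \<Phi> (\<lambda>z. \<xi> z + h z) y + \<Psi> (\<lambda>z. \<xi> z + h z) y - (\<Phi> \<xi> y + \<Psi> \<xi> y) - (L h y + M h y)) =
          (\<lambda>y. ?\<rho> y + ?\<sigma> y)"
        by (simp add: algebra_simps)
      moreover have "cinf_norm n (\<lambda>y. ?\<rho> y + ?\<sigma> y) \<le> cinf_norm n ?\<rho> + cinf_norm n ?\<sigma>"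
        using h by (intro cinf_norm_add smooths)
      ultimately show ?thesis
        using r[OF h] s[OF h] hr by simp
    qed
    with \<open>r > 0\<close> \<open>s > 0\<close> show "\<exists>r>0. \<forall>h. smooth h \<longrightarrow> cinf_norm m h < r \<longrightarrow>
      cinf_norm n (\<lambda>y. \<Phi> (\<lambda>z. \<xi> z + h z) y + \<Psi> (\<lambda>z. \<xi> z + h z) y - (\<Phi> \<xi> y + \<Psi> \<xi> y) - (L h y + M h y))
        \<le> \<epsilon> * cinf_norm m h"
      by (intro exI[of _ "min r s"]) auto
  qed
qed

lemma has_cinf_derivative_sum:
  assumes "\<And>i. i \<in> I \<Longrightarrow> has_cinf_derivative (\<Phi> i) (L i) \<xi>" and "smooth \<xi>"
  shows "has_cinf_derivative (\<lambda>\<zeta> y. \<Sum>i\<in>I. c i * \<Phi> i \<zeta> y) (\<lambda>h y. \<Sum>i\<in>I. c i * L i h y) \<xi>"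
  using assms(1)
proof (induction I rule: infinite_finite_induct)
  case (insert i I)
  have "has_cinf_derivative (\<lambda>\<zeta> y. c i * \<Phi> i \<zeta> y) (\<lambda>h y. c i * L i h y) \<xi>"
    using insert.prems assms(2)
    by (intro has_cinf_derivative_compose[where A = "\<lambda>h y. c i * h y"] cinf_linear_mult) auto
  with insert show ?case
    by (auto intro: has_cinf_derivative_add assms(2))
qed (auto intro: has_cinf_derivative_const)

text \<open>With remainders \<rho> and \<sigma> of the factors, the remainder of the product is
  \<rho> * \<Psi>(\<xi> + h) + (\<Phi>(\<xi>) + L h) * \<sigma> + L h * M h. The first two terms are
  o(h) times something bounded, the last is quadratic in h.\<close>

lemma has_cinf_derivative_mult:
  assumes \<Phi>: "has_cinf_derivative \<Phi> L \<xi>" and \<Psi>: "has_cinf_derivative \<Psi> M \<xi>" and \<xi>: "smooth \<xi>"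
  shows "has_cinf_derivative (\<lambda>\<zeta> y. \<Phi> \<zeta> y * \<Psi> \<zeta> y) (\<lambda>h y. L h y * \<Psi> \<xi> y + \<Phi> \<xi> y * M h y) \<xi>"
proof (rule has_cinf_derivativeI)
  note L = has_cinf_derivative_linear[OF \<Phi>] and M = has_cinf_derivative_linear[OF \<Psi>]
  note smooths = has_cinf_derivative_smooth[OF \<Phi>] has_cinf_derivative_smooth[OF \<Psi>]
    cinf_linear_smooth[OF L] cinf_linear_smooth[OF M] \<xi> smooth_add smooth_diff smooth_mult
  show "smooth (\<lambda>y. \<Phi> h y * \<Psi> h y)" if "smooth h" for h
    using that by (intro smooths)
  show "cinf_linear (\<lambda>h y. L h y * \<Psi> \<xi> y + \<Phi> \<xi> y * M h y)"
    using cinf_linear_plus[OF cinf_linear_compose[OF cinf_linear_mult L]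
        cinf_linear_compose[OF cinf_linear_mult M], of "\<Psi> \<xi>" "\<Phi> \<xi>"]
    by (simp add: smooths mult.commute)
  fix n
  obtain k1 where k1: "\<And>\<epsilon> m'. 0 < \<epsilon> \<Longrightarrow> k1 \<le> m' \<Longrightarrow> \<exists>r>0. \<forall>h. smooth h \<longrightarrow> cinf_norm m' h < r \<longrightarrow>
        cinf_norm n (\<lambda>y. \<Phi> (\<lambda>z. \<xi> z + h z) y - \<Phi> \<xi> y - L h y) \<le> \<epsilon> * cinf_norm m' h"
    using has_cinf_derivative_remainder[OF \<Phi>, of n] by blast
  obtain k2 where k2: "\<And>\<epsilon> m'. 0 < \<epsilon> \<Longrightarrow> k2 \<le> m' \<Longrightarrow> \<exists>r>0. \<forall>h. smooth h \<longrightarrow> cinf_norm m' h < r \<longrightarrow>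
        cinf_norm n (\<lambda>y. \<Psi> (\<lambda>z. \<xi> z + h z) y - \<Psi> \<xi> y - M h y) \<le> \<epsilon> * cinf_norm m' h"
    using has_cinf_derivative_remainder[OF \<Psi>, of n] by blast
  obtain l1 C1 where C1: "0 \<le> C1"
    and l1: "\<And>h m'. smooth h \<Longrightarrow> l1 \<le> m' \<Longrightarrow> cinf_norm n (L h) \<le> C1 * cinf_norm m' h"
    using cinf_linear_bound[OF L, of n] by blast
  obtain l2 C2 where C2: "0 \<le> C2"
    and l2: "\<And>h m'. smooth h \<Longrightarrow> l2 \<le> m' \<Longrightarrow> cinf_norm n (M h) \<le> C2 * cinf_norm m' h"
    using cinf_linear_bound[OF M, of n] by blast
  define m where "m = max (max k1 k2) (max l1 l2)"
  have km: "k1 \<le> m" "k2 \<le> m"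
    by (auto simp: m_def)
  \<comment> \<open>B majorises every bounded quantity at once; the summand 1 accounts for the
    remainder \<sigma> contained in \<Psi>(\<xi> + h).\<close>
  define B where "B = cinf_norm n (\<Phi> \<xi>) + cinf_norm n (\<Psi> \<xi>) + C1 + C2 + 1"
  have n\<Phi>: "0 \<le> cinf_norm n (\<Phi> \<xi>)" and n\<Psi>: "0 \<le> cinf_norm n (\<Psi> \<xi>)"
    by (auto intro: cinf_norm_nonneg smooths)
  then have B: "1 \<le> B" "C1 \<le> B" "C2 \<le> B" "cinf_norm n (\<Phi> \<xi>) + C1 \<le> B" "cinf_norm n (\<Psi> \<xi>) + C2 + 1 \<le> B"
    using C1 C2 by (auto simp: B_def)
  define N :: real where "N = 2 ^ n"
  have N: "0 < N" by (simp add: N_def)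
  let ?rem = "\<lambda>h y. \<Phi> (\<lambda>z. \<xi> z + h z) y * \<Psi> (\<lambda>z. \<xi> z + h z) y - \<Phi> \<xi> y * \<Psi> \<xi> y -
      (L h y * \<Psi> \<xi> y + \<Phi> \<xi> y * M h y)"
  show "\<exists>m. \<forall>\<epsilon>>0. \<exists>r>0. \<forall>h. smooth h \<longrightarrow> cinf_norm m h < r \<longrightarrow> cinf_norm n (?rem h) \<le> \<epsilon> * cinf_norm m h"
  proof (intro exI[of _ m] allI impI)
    fix \<epsilon> :: real assume "0 < \<epsilon>"
    \<comment> \<open>The second entry makes 2 * N * B * \<delta> at most \<epsilon> / 2, which pays
      for the two remainder terms; the first keeps \<sigma> of norm at most 1.\<close>
    define \<delta> where "\<delta> = min 1 (\<epsilon> / (4 * N * B))"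
    have \<delta>: "0 < \<delta>" "\<delta> \<le> 1" "\<delta> \<le> \<epsilon> / (4 * N * B)"
      using N B \<open>0 < \<epsilon>\<close> by (auto simp: \<delta>_def)
    from k1[OF \<delta>(1) km(1)] obtain r1 where "r1 > 0" and r1: "\<And>h. smooth h \<Longrightarrow> cinf_norm m h < r1 \<Longrightarrow>
        cinf_norm n (\<lambda>y. \<Phi> (\<lambda>z. \<xi> z + h z) y - \<Phi> \<xi> y - L h y) \<le> \<delta> * cinf_norm m h"
      by blast
    from k2[OF \<delta>(1) km(2)] obtain r2 where "r2 > 0" and r2: "\<And>h. smooth h \<Longrightarrow> cinf_norm m h < r2 \<Longrightarrow>
        cinf_norm n (\<lambda>y. \<Psi> (\<lambda>z. \<xi> z + h z) y - \<Psi> \<xi> y - M h y) \<le> \<delta> * cinf_norm m h"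
      by blast
    \<comment> \<open>The last entry makes N * B^2 * p at most \<epsilon> / 2, which pays for the
      quadratic term.\<close>
    define r where "r = min (min r1 r2) (min 1 (\<epsilon> / (2 * N * B\<^sup>2)))"
    have "cinf_norm n (?rem h) \<le> \<epsilon> * cinf_norm m h"
      if h: "smooth h" and hr: "cinf_norm m h < r" for h
    proof -
      define p where "p = cinf_norm m h"
      have p: "0 \<le> p" "p < r1" "p < r2" "p \<le> 1" "p \<le> \<epsilon> / (2 * N * B\<^sup>2)"
        using hr cinf_norm_nonneg[OF h, of m] by (auto simp: p_def r_def)
      let ?\<rho> = "\<lambda>y. \<Phi> (\<lambda>z. \<xi> z + h z) y - \<Phi> \<xi> y - L h y"
      let ?\<sigma> = "\<lambda>y. \<Psi> (\<lambda>z. \<xi> z + h z) y - \<Psi> \<xi> y - M h y"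
      let ?\<Psi>' = "\<Psi> (\<lambda>z. \<xi> z + h z)"
      have \<rho>: "cinf_norm n ?\<rho> \<le> \<delta> * p" and \<sigma>: "cinf_norm n ?\<sigma> \<le> \<delta> * p"
        using r1[OF h] r2[OF h] p by (auto simp: p_def)
      have Lh: "cinf_norm n (L h) \<le> C1 * p" and Mh: "cinf_norm n (M h) \<le> C2 * p"
        using l1[OF h, of m] l2[OF h, of m] by (auto simp: p_def m_def)
      have C1p: "C1 * p \<le> C1" and C2p: "C2 * p \<le> C2"
        using mult_left_mono[OF p(4) C1] mult_left_mono[OF p(4) C2] by auto
      have \<delta>p: "\<delta> * p \<le> 1"
        using mult_mono[OF \<delta>(2) p(4)] p(1) by simp
      have \<Psi>': "cinf_norm n ?\<Psi>' \<le> B"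
      proof -
        have "cinf_norm n (\<lambda>y. (\<Psi> \<xi> y + M h y) + ?\<sigma> y) \<le> cinf_norm n (\<lambda>y. \<Psi> \<xi> y + M h y) + cinf_norm n ?\<sigma>"
          using h by (intro cinf_norm_add smooths)
        also have "cinf_norm n (\<lambda>y. \<Psi> \<xi> y + M h y) \<le> cinf_norm n (\<Psi> \<xi>) + cinf_norm n (M h)"
          using h by (intro cinf_norm_add smooths)
        finally show ?thesis
          using B \<sigma> Mh C2p \<delta>p by simp
      qed
      have \<Phi>L: "cinf_norm n (\<lambda>y. \<Phi> \<xi> y + L h y) \<le> B"
        using cinf_norm_add[of "\<Phi> \<xi>" "L h" n] h Lh C1p B by (simp add: smooths)
      let ?a = "\<lambda>y. ?\<rho> y * ?\<Psi>' y" and ?b = "\<lambda>y. (\<Phi> \<xi> y + L h y) * ?\<sigma> y" and ?c = "\<lambda>y. L h y * M h y"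
      have nn: "0 \<le> cinf_norm n u" if "smooth u" for u :: "real ^ 'a \<Rightarrow> real"
        by (rule cinf_norm_nonneg[OF that])
      have a: "cinf_norm n ?a \<le> N * (\<delta> * p * B)"
      proof -
        have "cinf_norm n ?a \<le> N * (cinf_norm n ?\<rho> * cinf_norm n ?\<Psi>')"
          unfolding N_def using h by (intro cinf_norm_mult smooths)
        also have "\<dots> \<le> N * (\<delta> * p * B)"
          using N h p \<delta> by (intro mult_left_mono mult_mono \<rho> \<Psi>' nn smooths) auto
        finally show ?thesis .
      qed
      have b: "cinf_norm n ?b \<le> N * (B * (\<delta> * p))"
      proof -
        have "cinf_norm n ?b \<le> N * (cinf_norm n (\<lambda>y. \<Phi> \<xi> y + L h y) * cinf_norm n ?\<sigma>)"
          unfolding N_def using h by (intro cinf_norm_mult smooths)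
        also have "\<dots> \<le> N * (B * (\<delta> * p))"
          using N h B by (intro mult_left_mono mult_mono \<sigma> \<Phi>L nn smooths) auto
        finally show ?thesis .
      qed
      have c: "cinf_norm n ?c \<le> N * ((B * p) * (B * p))"
      proof -
        have "cinf_norm n ?c \<le> N * (cinf_norm n (L h) * cinf_norm n (M h))"
          unfolding N_def using h by (intro cinf_norm_mult smooths)
        also have "\<dots> \<le> N * ((B * p) * (B * p))"
        proof (intro mult_left_mono mult_mono nn smooths h)
          show "cinf_norm n (L h) \<le> B * p"
            using Lh mult_right_mono[OF B(2) p(1)] by linarith
          show "cinf_norm n (M h) \<le> B * p"
            using Mh mult_right_mono[OF B(3) p(1)] by linarith
        qed (use N B p in auto)
        finally show ?thesis .
      qed
      have "?rem h = (\<lambda>y. (?a y + ?b y) + ?c y)"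
        by (simp add: algebra_simps)
      then have "cinf_norm n (?rem h) = cinf_norm n (\<lambda>y. (?a y + ?b y) + ?c y)"
        by (rule arg_cong)
      also have "\<dots> \<le> cinf_norm n (\<lambda>y. ?a y + ?b y) + cinf_norm n ?c"
        using h by (intro cinf_norm_add smooths)
      also have "cinf_norm n (\<lambda>y. ?a y + ?b y) \<le> cinf_norm n ?a + cinf_norm n ?b"
        using h by (intro cinf_norm_add smooths)
      finally have "cinf_norm n (?rem h) \<le> N * (\<delta> * p * B) + N * (B * (\<delta> * p)) + N * ((B * p) * (B * p))"
        using a b c by linarith
      also have "\<dots> = (2 * N * B * \<delta> + N * B\<^sup>2 * p) * p"
        by (simp add: algebra_simps power2_eq_square)
      also have "\<dots> \<le> (\<epsilon> / 2 + \<epsilon> / 2) * p"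
      proof (intro mult_right_mono add_mono p)
        show "2 * N * B * \<delta> \<le> \<epsilon> / 2"
          using \<delta>(3) N B(1) by (simp add: field_simps)
        show "N * B\<^sup>2 * p \<le> \<epsilon> / 2"
          using p(5) N B(1) by (simp add: field_simps)
      qed
      finally show ?thesis
        by (simp add: p_def)
    qed
    moreover have "r > 0"
      using \<open>r1 > 0\<close> \<open>r2 > 0\<close> \<open>0 < \<epsilon>\<close> N B(1) by (simp add: r_def)
    ultimately show "\<exists>r>0. \<forall>h. smooth h \<longrightarrow> cinf_norm m h < r \<longrightarrow> cinf_norm n (?rem h) \<le> \<epsilon> * cinf_norm m h"
      by blast
  qed
qed

text \<open>The formulas for the derivative may differ off the smooth directions. This is used for
  planted trees, where the operator commutes with the linear combination only for smooth h.\<close>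

lemma has_cinf_derivative_cong:
  assumes "has_cinf_derivative \<Phi> L \<xi>"
    and "\<And>h. \<Psi> h = \<Phi> h" and "\<And>h. smooth h \<Longrightarrow> M h = L h"
  shows "has_cinf_derivative \<Psi> M \<xi>"
proof -
  have "\<Psi> = \<Phi>" using assms(2) by blast
  moreover have "has_cinf_derivative \<Phi> M \<xi>"
    using assms(1) unfolding has_cinf_derivative_def
    by (simp add: assms(3) smooth_add smooth_cmult cong: imp_cong)
  ultimately show ?thesis by simp
qed


section \<open>Convolution with an integrable kernel\<close>

text \<open>\<open>partial\<close> only records the derivative on basis vectors; linearity recovers
  the whole derivative from the gradient.\<close>

lemma has_derivative_gradient:
  fixes g :: "real ^ 'n::finite \<Rightarrow> real"
  assumes "g differentiable (at w)"
  shows "(g has_derivative (\<lambda>v. (\<chi> j. partial j g w) \<bullet> v)) (at w)"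
proof -
  let ?D = "frechet_derivative g (at w)"
  have D: "(g has_derivative ?D) (at w)"
    using assms by (rule frechet_derivative_works[THEN iffD1])
  then have lin: "linear ?D"
    by (rule has_derivative_linear)
  have expansion: "(\<Sum>j\<in>UNIV. v $ j *\<^sub>R axis j 1) = v" for v :: "real ^ 'n"
    using basis_expansion[of v] by (simp only: scalar_mult_eq_scaleR)
  have D_eq: "?D v = (\<Sum>j\<in>UNIV. v $ j * ?D (axis j 1))" for v
  proof -
    have "?D v = ?D (\<Sum>j\<in>UNIV. v $ j *\<^sub>R axis j 1)"
      by (simp only: expansion)
    also have "\<dots> = (\<Sum>j\<in>UNIV. v $ j * ?D (axis j 1))"
      by (simp only: linear_sum[OF lin] linear_scale[OF lin] real_scaleR_def)
    finally show ?thesis .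
  qed
  have "?D = (\<lambda>v. (\<chi> j. partial j g w) \<bullet> v)"
    by (rule ext, subst D_eq) (simp add: partial_def inner_vec_def mult.commute)
  with D show ?thesis by simp
qed

text \<open>The gradient is uniformly continuous on the ball of radius r + 1, and the mean value
  inequality turns this into a first-order expansion uniform in w. The bound 1 on the increment
  keeps the segment inside the larger ball. Uniformity is what allows integration against a
  kernel.\<close>

lemma smooth_linearization:
  fixes g :: "real ^ 'n::finite \<Rightarrow> real"
  assumes g: "smooth g" and "0 < e"
  shows "\<exists>d>0. \<forall>w v. norm w \<le> r \<longrightarrow> norm v < d \<longrightarrow>
      \<bar>g (w + v) - g w - (\<chi> j. partial j g w) \<bullet> v\<bar> \<le> e * norm v"
proof -
  let ?G = "\<lambda>w. \<chi> j. partial j g w"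
  have "continuous_on (cball 0 (r + 1)) ?G"
    by (intro continuous_on_vec_lambda smooth_continuous_on smooth_partial g)
  then have "uniformly_continuous_on (cball 0 (r + 1)) ?G"
    by (intro compact_uniformly_continuous compact_cball)
  then have "\<exists>d>0. \<forall>w\<in>cball 0 (r + 1). \<forall>u\<in>cball 0 (r + 1). dist u w < d \<longrightarrow> dist (?G u) (?G w) < e"
    using \<open>0 < e\<close> unfolding uniformly_continuous_on_def by simp
  then obtain d where "0 < d"
    and d: "\<forall>w\<in>cball 0 (r + 1). \<forall>u\<in>cball 0 (r + 1). dist u w < d \<longrightarrow> dist (?G u) (?G w) < e"
    by (elim exE conjE)
  show ?thesis
  proof (intro exI[of _ "min d 1"] conjI allI impI)
    show "0 < min d 1" using \<open>0 < d\<close> by simp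
    fix w v :: "real ^ 'n" assume w: "norm w \<le> r" and v: "norm v < min d 1"
    let ?S = "ball w (min d 1)"
    have "norm (g (w + v) - g w - ?G w \<bullet> (w + v - w)) \<le> norm (w + v - w) * e"
    proof (rule differentiable_bound_linearization[where S = ?S and f' = "\<lambda>w v. ?G w \<bullet> v" and f = g
          and a = w and b = "w + v" and ?x0.0 = w and B = e])
      show "w + t *\<^sub>R (w + v - w) \<in> ?S" if "t \<in> {0..1}" for t
      proof -
        have "norm (t *\<^sub>R v) \<le> norm v"
          using that by (simp add: mult_left_le_one_le)
        then show ?thesis
          using v by (simp add: dist_norm)
      qed
      show "(g has_derivative (\<bullet>) (?G u)) (at u within ?S)" for u
        by (rule has_derivative_at_withinI[OF has_derivative_gradient[OF smooth_differentiable[OF g]]])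
      show "onorm ((\<bullet>) (?G u) - (\<bullet>) (?G w)) \<le> e" if "u \<in> ?S" for u
      proof (rule onorm_bound)
        fix x :: "real ^ 'n"
        have "norm u \<le> norm w + dist w u"
          by (metis add.commute diff_add_cancel dist_commute dist_norm norm_triangle_ineq)
        then have "dist (?G u) (?G w) < e"
          using that w by (intro d[rule_format]) (auto simp: dist_commute)
        then have "norm (?G u - ?G w) * norm x \<le> e * norm x"
          by (intro mult_right_mono) (auto simp: dist_norm)
        then show "norm (((\<bullet>) (?G u) - (\<bullet>) (?G w)) x) \<le> e * norm x"
          using Cauchy_Schwarz_ineq2[of "?G u - ?G w" x] by (simp add: inner_diff_left)
      qed (use \<open>0 < e\<close> in simp)
      show "w \<in> ?S"
        using \<open>0 < d\<close> by simp
    qed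
    then show "\<bar>g (w + v) - g w - ?G w \<bullet> v\<bar> \<le> e * norm v"
      by (simp add: mult.commute)
  qed
qed

text \<open>The convolution estimates see only the L1 norm of the kernel and the radius of its
  support; how singular it is at the origin is irrelevant to them.\<close>

locale integrable_kernel =
  fixes K :: "real ^ 'n::finite \<Rightarrow> real" and \<rho> :: real
  assumes integrable_K: "integrable lborel K"
    and K_support: "\<And>z. \<rho> < norm z \<Longrightarrow> K z = 0"
begin

definition conv :: "(real ^ 'n \<Rightarrow> real) \<Rightarrow> (real ^ 'n \<Rightarrow> real)" where
  "conv g = (\<lambda>y. \<integral>z. K z * g (y - z) \<partial>lborel)"

text \<open>The factor f may grow at infinity: outside the ball of radius \<rho> the kernel
  vanishes, so |K| * B dominates everywhere.\<close>

lemma integrable_mult_bounded: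
  assumes f: "continuous_on UNIV f" and b: "\<And>z. norm z \<le> \<rho> \<Longrightarrow> \<bar>f z\<bar> \<le> B"
  shows "integrable lborel (\<lambda>z. K z * f z)"
    and "\<bar>\<integral>z. K z * f z \<partial>lborel\<bar> \<le> (\<integral>z. \<bar>K z\<bar> \<partial>lborel) * B"
proof -
  have bound: "\<bar>K z * f z\<bar> \<le> \<bar>K z\<bar> * B" for z
    using b[of z] K_support[of z] by (cases "norm z \<le> \<rho>") (auto simp: abs_mult mult_left_mono)
  have iK: "integrable lborel (\<lambda>z. \<bar>K z\<bar> * B)"
    by (intro integrable_mult_left integrable_abs integrable_K)
  have "norm (K z * f z) \<le> norm (\<bar>K z\<bar> * B)" for z
    using bound[of z] by simp
  then show int: "integrable lborel (\<lambda>z. K z * f z)"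
    using borel_measurable_continuous_onI[OF f] borel_measurable_integrable[OF integrable_K]
    by (intro Bochner_Integration.integrable_bound[OF iK]) auto
  have "\<bar>\<integral>z. K z * f z \<partial>lborel\<bar> \<le> (\<integral>z. \<bar>K z * f z\<bar> \<partial>lborel)"
    by (rule integral_abs_bound)
  also have "\<dots> \<le> (\<integral>z. \<bar>K z\<bar> * B \<partial>lborel)"
    by (intro integral_mono integrable_abs int iK bound)
  finally show "\<bar>\<integral>z. K z * f z \<partial>lborel\<bar> \<le> (\<integral>z. \<bar>K z\<bar> \<partial>lborel) * B"
    by simp
qed

lemma integrable_conv:
  assumes "continuous_on UNIV g"
  shows "integrable lborel (\<lambda>z. K z * g (y - z))"
proof -
  have c: "continuous_on S (\<lambda>z. g (y - z))" for S
    by (intro continuous_on_compose2[OF assms, of S "\<lambda>z. y - z"] continuous_intros) simp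
  have "bounded ((\<lambda>z. g (y - z)) ` cball 0 \<rho>)"
    by (intro compact_imp_bounded compact_continuous_image c compact_cball)
  then obtain B where "\<forall>x\<in>cball 0 \<rho>. \<bar>g (y - x)\<bar> \<le> B"
    by (auto simp: bounded_iff)
  then have "\<And>z. norm z \<le> \<rho> \<Longrightarrow> \<bar>g (y - z)\<bar> \<le> B"
    by simp
  then show ?thesis
    by (rule integrable_mult_bounded(1)[OF c])
qed

text \<open>Differentiation under the integral: the remainder of the convolution is the integral of
  K against the first-order remainder of g at y - z, and these points stay in a fixed ball where the
  expansion of g is uniform.\<close>

lemma conv_has_derivative:
  assumes g: "smooth g"
  shows "(conv g has_derivative (\<lambda>v. (\<chi> j. conv (partial j g) y) \<bullet> v)) (at y)"
  unfolding has_derivative_at_alt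
proof (intro conjI allI impI)
  show "bounded_linear (\<lambda>v. (\<chi> j. conv (partial j g) y) \<bullet> v)"
    by (rule bounded_linear_inner_right)
  fix e :: real assume "0 < e"
  define M where "M = (\<integral>z. \<bar>K z\<bar> \<partial>lborel)"
  have M: "0 \<le> M" by (simp add: M_def)
  let ?G = "\<lambda>w. \<chi> j. partial j g w"
  \<comment> \<open>Integration against K costs the factor M; the added 1 covers M = 0.\<close>
  obtain d where "0 < d" and d: "\<And>w v. norm w \<le> norm y + \<rho> \<Longrightarrow> norm v < d \<Longrightarrow>
      \<bar>g (w + v) - g w - ?G w \<bullet> v\<bar> \<le> e / (M + 1) * norm v"
    using smooth_linearization[OF g, of "e / (M + 1)" "norm y + \<rho>"] \<open>0 < e\<close> M by auto
  have "norm (conv g x - conv g y - (\<chi> j. conv (partial j g) y) \<bullet> (x - y)) \<le> e * norm (x - y)"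
    if "norm (x - y) < d" for x
  proof -
    let ?v = "x - y"
    have cont: "continuous_on UNIV g" "continuous_on UNIV (partial j g)" for j
      by (intro smooth_continuous_on smooth_partial g)+
    have "conv g x - conv g y - (\<chi> j. conv (partial j g) y) \<bullet> ?v =
        conv g x - conv g y - (\<Sum>j\<in>UNIV. (\<integral>z. K z * partial j g (y - z) \<partial>lborel) * ?v $ j)"
      by (simp add: inner_vec_def conv_def)
    also have "\<dots> = (\<integral>z. K z * g (x - z) - K z * g (y - z) -
        (\<Sum>j\<in>UNIV. K z * partial j g (y - z) * ?v $ j) \<partial>lborel)"
      by (simp add: conv_def integrable_conv cont)
    also have "\<dots> = (\<integral>z. K z * (g ((y - z) + ?v) - g (y - z) - ?G (y - z) \<bullet> ?v) \<partial>lborel)"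
      by (simp add: inner_vec_def algebra_simps sum_distrib_left)
    also have "\<bar>\<dots>\<bar> \<le> M * (e / (M + 1) * norm ?v)"
      unfolding M_def
    proof (rule integrable_mult_bounded)
      show "continuous_on UNIV (\<lambda>z. g (y - z + ?v) - g (y - z) - ?G (y - z) \<bullet> ?v)"
        by (intro continuous_intros continuous_on_compose2[OF cont(1)] continuous_on_compose2[OF cont(2)]) auto
      fix z :: "real ^ 'n" assume "norm z \<le> \<rho>"
      then have "norm (y - z) \<le> norm y + \<rho>"
        using norm_triangle_ineq4[of y z] by linarith
      from d[OF this that]
      show "\<bar>g (y - z + ?v) - g (y - z) - ?G (y - z) \<bullet> ?v\<bar> \<le> e / ((\<integral>z. \<bar>K z\<bar> \<partial>lborel) + 1) * norm ?v"
        by (simp add: M_def)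
    qed
    also have "\<dots> \<le> e * norm ?v"
      using M \<open>0 < e\<close> mult_nonneg_nonneg[of e "norm ?v"] by (simp add: field_simps)
    finally show ?thesis by simp
  qed
  with \<open>0 < d\<close> show "\<exists>d>0. \<forall>x. norm (x - y) < d \<longrightarrow>
      norm (conv g x - conv g y - (\<chi> j. conv (partial j g) y) \<bullet> (x - y)) \<le> e * norm (x - y)"
    by blast
qed

lemma partial_conv: "smooth g \<Longrightarrow> partial j (conv g) = conv (partial j g)"
  by (subst partial_eq[OF conv_has_derivative]) (simp_all add: inner_axis)

lemma partials_conv: "smooth g \<Longrightarrow> partials js (conv g) = conv (partials js g)"
  by (induction js) (simp_all add: partial_conv smooth_partials)

lemma smooth_conv:
  assumes "smooth g"
  shows "smooth (conv g)"
proof (rule smooth_coinduct[where S = "conv ` {g. smooth g}"])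
  show "f differentiable (at x)" if "f \<in> conv ` {g. smooth g}" for f x
    using that conv_has_derivative by (auto simp: differentiable_def)
qed (use assms in \<open>auto simp: partial_conv smooth_partial\<close>)

text \<open>All derivatives fall on h, so no order is lost; only the ball grows, since y - z ranges
  over points of norm up to n + \<rho>.\<close>

lemma cinf_linear_conv: "cinf_linear conv"
proof (rule cinf_linearI)
  fix n
  define m where "m = n + nat \<lceil>\<rho>\<rceil>"
  have "cinf_norm n (conv h) \<le> (\<integral>z. \<bar>K z\<bar> \<partial>lborel) * cinf_norm m h" if h: "smooth h" for h
  proof (rule cinf_norm_least)
    fix js :: "'n list" and y :: "real ^ 'n" assume "length js \<le> n" "norm y \<le> real n"
    have "\<bar>\<integral>z. K z * partials js h (y - z) \<partial>lborel\<bar> \<le> (\<integral>z. \<bar>K z\<bar> \<partial>lborel) * cinf_norm m h"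
    proof (rule integrable_mult_bounded)
      show "continuous_on UNIV (\<lambda>z. partials js h (y - z))"
        by (intro continuous_on_compose2[OF smooth_continuous_on[OF smooth_partials[OF h]]] continuous_intros) auto
      fix z :: "real ^ 'n" assume "norm z \<le> \<rho>"
      then have "norm (y - z) \<le> real m"
        using norm_triangle_ineq4[of y z] \<open>norm y \<le> real n\<close> unfolding m_def by linarith
      then show "\<bar>partials js h (y - z)\<bar> \<le> cinf_norm m h"
        using \<open>length js \<le> n\<close> by (intro cinf_norm_upper h) (auto simp: m_def)
    qed
    then show "\<bar>partials js (conv h) y\<bar> \<le> (\<integral>z. \<bar>K z\<bar> \<partial>lborel) * cinf_norm m h"
      by (simp add: partials_conv h) (simp add: conv_def)
  qed
  then show "\<exists>m C. \<forall>h. smooth h \<longrightarrow> cinf_norm n (conv h) \<le> C * cinf_norm m h"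
    by blast
next
  fix h g :: "real ^ 'n \<Rightarrow> real"
  assume "smooth h" "smooth g"
  then show "conv (\<lambda>y. h y + g y) = (\<lambda>y. conv h y + conv g y)"
    by (simp add: conv_def distrib_left integrable_conv smooth_continuous_on)
next
  fix c and h :: "real ^ 'n \<Rightarrow> real"
  show "conv (\<lambda>y. c * h y) = (\<lambda>y. c * conv h y)"
    by (simp add: conv_def mult.left_commute)
qed (rule smooth_conv)

end


section \<open>Integrability of the truncated heat kernel\<close>

text \<open>Tonelli for products of one-variable functions, moved from basis vectors to coordinates
  by inverting i \<mapsto> \<open>axis i 1\<close>.\<close>

lemma nn_integral_vec_prod:
  fixes f :: "'n::finite \<Rightarrow> real \<Rightarrow> ennreal"
  assumes [measurable]: "\<And>i. f i \<in> borel_measurable borel"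
  shows "(\<integral>\<^sup>+x. (\<Prod>i\<in>UNIV. f i (x $ i)) \<partial>lborel) = (\<Prod>i\<in>UNIV. \<integral>\<^sup>+u. f i u \<partial>lborel)"
proof -
  have Basis: "(Basis :: (real ^ 'n) set) = range (\<lambda>i. axis i 1)"
    by (auto simp: Basis_vec_def)
  have inj: "inj (\<lambda>i. axis i 1 :: real ^ 'n)"
    by (auto simp: inj_def axis_eq_axis)
  define F where "F b = f (inv (\<lambda>i. axis i 1) b)" for b :: "real ^ 'n"
  have F: "F (axis i 1) = f i" for i
    unfolding F_def using inv_f_f[OF inj, of i] by simp
  have "(\<integral>\<^sup>+x. (\<Prod>b\<in>Basis. F b (x \<bullet> b)) \<partial>lborel) = (\<Prod>b\<in>Basis. \<integral>\<^sup>+u. F b u \<partial>lborel)"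
    by (rule nn_integral_lborel_prod) (auto simp: F_def)
  then show ?thesis
    by (simp add: Basis prod.reindex inj F inner_axis)
qed

text \<open>The integrand is dominated by a function on [0, r] plus its reflection, which have the
  same integral.\<close>

lemma nn_integral_abs_powr_finite:
  assumes "a < 1" and "0 \<le> r"
  shows "(\<integral>\<^sup>+u. indicator {-r..r} u * ennreal (\<bar>u\<bar> powr (-a)) \<partial>lborel) < \<infinity>"
proof -
  define g where "g u = ennreal (u powr (-a)) * indicator {0..r} u" for u :: real
  have [measurable]: "g \<in> borel_measurable borel"
    unfolding g_def by measurable
  have "(\<lambda>u. u powr (-a)) integrable_on {0..r}"
    using assms by (intro integrable_on_powr_from_0) auto
  then obtain I where "((\<lambda>u. u powr (-a)) has_integral I) {0..r}"
    by blast
  then have I: "(\<integral>\<^sup>+u. g u \<partial>lborel) = ennreal I"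
    unfolding g_def by (intro nn_integral_has_integral_lebesgue') auto
  have "(\<integral>\<^sup>+u. indicator {-r..r} u * ennreal (\<bar>u\<bar> powr (-a)) \<partial>lborel) \<le> (\<integral>\<^sup>+u. g u + g (0 + (-1) * u) \<partial>lborel)"
    by (intro nn_integral_mono) (auto simp: g_def indicator_def)
  also have "\<dots> = (\<integral>\<^sup>+u. g u \<partial>lborel) + (\<integral>\<^sup>+u. g (0 + (-1) * u) \<partial>lborel)"
    by (rule nn_integral_add) measurable
  also have "(\<integral>\<^sup>+u. g (0 + (-1) * u) \<partial>lborel) = (\<integral>\<^sup>+u. g u \<partial>lborel)"
    using nn_integral_real_affine[of g "-1" 0] by simp
  finally show ?thesis
    unfolding I by (auto simp: less_top[symmetric] top_unique)
qed

text \<open>Taking logarithms, the claim is s * ln w \<le> w, which follows from ln w \<le> w -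
  1.\<close>

lemma exp_minus_le_powr:
  fixes w s :: real
  assumes "0 < w" and "0 \<le> s" and "s \<le> 1"
  shows "exp (- w) \<le> w powr (- s)"
proof -
  have "s * ln w \<le> w"
  proof (cases "0 \<le> ln w")
    case True
    then have "s * ln w \<le> 1 * ln w"
      using assms by (intro mult_right_mono)
    with ln_le_minus_one[OF \<open>0 < w\<close>] show ?thesis by linarith
  next
    case False
    then have "s * ln w \<le> 0"
      using assms by (simp add: mult_nonneg_nonpos)
    with \<open>0 < w\<close> show ?thesis by linarith
  qed
  then show ?thesis
    using assms by (simp add: powr_def)
qed

text \<open>Each factor \<open>t\<^sup>-\<^sup>1\<^sup>/\<^sup>2 exp (- x\<^sub>i\<^sup>2 / (4 t))\<close> of the heat kernel is bounded with \<open>exp (- w) \<le> w\<^sup>-\<^sup>s\<^sup>/\<^sup>2\<close>, where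
  \<open>s = 1 - 1/d\<close>. This leaves the powers \<open>t\<^sup>-\<^sup>1\<^sup>/\<^sup>2\<close> and \<open>\<bar>x\<^sub>i\<bar>\<^sup>-\<^sup>s\<close>, all of which are integrable at \<open>0\<close>.\<close>

definition heat_exponent :: "'d::finite option \<Rightarrow> real" where
  "heat_exponent j = (case j of None \<Rightarrow> 1 / 2 | Some i \<Rightarrow> 1 - 1 / real CARD('d))"

lemma heat_kernel_nonneg: "0 \<le> heat_kernel z"
  by (simp add: heat_kernel_def)

lemma heat_kernel_le:
  fixes z :: "'d::finite st"
  assumes nz: "\<And>j. z $ j \<noteq> 0"
  shows "heat_kernel z \<le> (\<Prod>j\<in>UNIV. \<bar>z $ j\<bar> powr (- heat_exponent j))"
proof (cases "0 < z $ None")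
  case False
  then show ?thesis by (simp add: heat_kernel_def prod_nonneg)
next
  case True
  define t where "t = z $ None"
  define D where "D = real CARD('d)"
  define s where "s = 1 - 1 / D"
  have t: "0 < t" and D: "1 \<le> D"
    using True by (simp_all add: t_def D_def Suc_leI)
  have s: "0 \<le> s" "s \<le> 1"
    using D by (auto simp: s_def field_simps)
  have "exp (- (\<Sum>i\<in>UNIV. (z $ Some i)\<^sup>2) / (4 * t)) = (\<Prod>i\<in>UNIV. exp (- ((z $ Some i)\<^sup>2 / (4 * t))))"
    by (simp add: exp_sum[symmetric] sum_divide_distrib sum_negf)
  also have "\<dots> \<le> (\<Prod>i\<in>UNIV. (4 * t) powr (s / 2) * \<bar>z $ Some i\<bar> powr (- s))"
  proof (intro prod_mono conjI)
    fix i
    let ?u = "\<bar>z $ Some i\<bar>"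
    have u: "0 < ?u" using nz by simp
    have "exp (- ((z $ Some i)\<^sup>2 / (4 * t))) \<le> ((z $ Some i)\<^sup>2 / (4 * t)) powr (- (s / 2))"
      using nz t s by (intro exp_minus_le_powr) auto
    also have "\<dots> = (4 * t) powr (s / 2) * ?u powr (- s)"
    proof -
      have sq: "(z $ Some i)\<^sup>2 = ?u powr 2"
        using u by simp
      show ?thesis
        unfolding sq using u t by (simp add: powr_divide powr_powr powr_minus field_simps del: powr_numeral)
    qed
    finally show "exp (- ((z $ Some i)\<^sup>2 / (4 * t))) \<le> (4 * t) powr (s / 2) * ?u powr (- s)" .
  qed simp
  also have "\<dots> = (4 * t) powr (D * s / 2) * (\<Prod>i\<in>UNIV. \<bar>z $ Some i\<bar> powr (- s))"
    using t by (simp add: prod.distrib D_def powr_realpow[symmetric] powr_powr mult.commute)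
  finally have ex: "exp (- (\<Sum>i\<in>UNIV. (z $ Some i)\<^sup>2) / (4 * t)) \<le>
      (4 * t) powr (D * s / 2) * (\<Prod>i\<in>UNIV. \<bar>z $ Some i\<bar> powr (- s))" .
  have "4 * t \<le> 4 * pi * t"
    using t pi_gt3 by simp
  then have p: "(4 * pi * t) powr (- D / 2) \<le> (4 * t) powr (- D / 2)"
    using t D by (intro powr_mono2') auto
  \<comment> \<open>The choice of s shows here: D * (1 - s) = 1, so the powers of t combine to the
    exponent -1/2, integrable at 0 in every dimension.\<close>
  have q: "(4 * t) powr (- D / 2) * (4 * t) powr (D * s / 2) \<le> t powr (- (1 / 2))"
  proof -
    have "(4 * t) powr (- D / 2) * (4 * t) powr (D * s / 2) = (4 * t) powr (- (1 / 2))"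
      using D by (simp add: powr_add[symmetric] s_def field_simps)
    also have "\<dots> \<le> t powr (- (1 / 2))"
      using t by (intro powr_mono2') auto
    finally show ?thesis .
  qed
  have "heat_kernel z = (4 * pi * t) powr (- D / 2) * exp (- (\<Sum>i\<in>UNIV. (z $ Some i)\<^sup>2) / (4 * t))"
    using True by (simp add: heat_kernel_def t_def D_def)
  also have "\<dots> \<le> (4 * t) powr (- D / 2) * ((4 * t) powr (D * s / 2) * (\<Prod>i\<in>UNIV. \<bar>z $ Some i\<bar> powr (- s)))"
    by (intro mult_mono p ex) auto
  also have "\<dots> \<le> t powr (- (1 / 2)) * (\<Prod>i\<in>UNIV. \<bar>z $ Some i\<bar> powr (- s))"
    using mult_right_mono[OF q, of "\<Prod>i\<in>UNIV. \<bar>z $ Some i\<bar> powr (- s)"] by (simp add: prod_nonneg mult.assoc)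
  also have "\<dots> = (\<Prod>j\<in>UNIV. \<bar>z $ j\<bar> powr (- heat_exponent j))"
    using t by (simp add: UNIV_option_conv prod.reindex heat_exponent_def t_def s_def D_def)
  finally show ?thesis .
qed

text \<open>Near the origin K is dominated by a product of integrable one-variable powers on a box;
  on the rest of the compact support it is continuous, hence bounded.\<close>

lemma truncated_heat_kernel_integrable:
  fixes K :: "'d::finite st \<Rightarrow> real"
  assumes "truncated_heat_kernel K"
  shows "integrable lborel K"
proof -
  obtain C r where "compact C" and C: "\<And>z. z \<notin> C \<Longrightarrow> K z = 0" and "0 < r"
    and heat: "\<And>z. z \<in> ball 0 r - {0} \<Longrightarrow> K z = heat_kernel z" and smooth: "smooth_on (- {0}) K"
    using assms unfolding truncated_heat_kernel_def by blast
  have "K differentiable (at x)" if "x \<noteq> 0" for x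
    using smooth that unfolding smooth_on_def by (metis ComplI partials_Nil singletonD)
  then have cont: "continuous_on S K" if "0 \<notin> S" for S
    using that by (metis continuous_at_imp_continuous_on differentiable_imp_continuous_within)
  \<comment> \<open>Nothing is known about K at the origin, so measurability comes from the
    continuous part off 0 plus a single value at 0.\<close>
  have "(\<lambda>z. indicator (- {0}) z *\<^sub>R K z) \<in> borel_measurable borel"
    by (intro borel_measurable_continuous_on_indicator cont) auto
  then have "(\<lambda>z. indicator (- {0}) z *\<^sub>R K z + indicator {0} z * K 0) \<in> borel_measurable borel"
    by measurable
  also have "(\<lambda>z. indicator (- {0}) z *\<^sub>R K z + indicator {0} z * K 0) = K"
    by (auto simp: indicator_def)
  finally have [measurable]: "K \<in> borel_measurable borel" .
  have "compact (K ` (C - ball 0 r))"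
    using \<open>0 < r\<close> \<open>compact C\<close> by (intro compact_continuous_image cont compact_diff) auto
  then obtain B where B: "\<And>z. z \<in> C - ball 0 r \<Longrightarrow> \<bar>K z\<bar> \<le> B"
    using compact_imp_bounded by (force simp: bounded_iff)
  define f where "f j u = indicator {-r..r} u * ennreal (\<bar>u\<bar> powr (- heat_exponent j))"
    for j :: "'d option" and u
  have [measurable]: "f j \<in> borel_measurable borel" for j
    unfolding f_def by measurable
  have [measurable]: "C \<in> sets borel"
    using \<open>compact C\<close> by (simp add: borel_compact)
  \<comment> \<open>The bound by negative powers fails where a coordinate vanishes (such powers are
    0 there), but the coordinate hyperplanes are null sets.\<close>
  have AE: "AE z in lborel. \<forall>j. (z :: 'd st) $ j \<noteq> 0"
  proof -
    have "AE z in lborel. (z :: 'd st) $ j \<noteq> 0" for j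
      using AE_lborel_inner_neq[of "axis j 1 :: 'd st" 0] by (simp add: inner_axis)
    then show ?thesis by (simp add: AE_all_countable)
  qed
  have bound: "ennreal (norm (K z)) \<le> ennreal B * indicator C z + (\<Prod>j\<in>UNIV. f j (z $ j))"
    if nz: "\<forall>j. z $ j \<noteq> 0" for z
  proof (cases "z \<in> ball 0 r")
    case True
    have "z \<noteq> 0" using nz by auto
    with True have Kz: "K z = heat_kernel z"
      by (intro heat) auto
    have "\<bar>z $ j\<bar> \<le> r" for j
      using component_le_norm_cart[of z j] True by simp
    then have "(\<Prod>j\<in>UNIV. f j (z $ j)) = (\<Prod>j\<in>UNIV. ennreal (\<bar>z $ j\<bar> powr (- heat_exponent j)))"
      by (intro prod.cong) (auto simp: f_def indicator_def abs_le_iff minus_le_iff)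
    also have "\<dots> = ennreal (\<Prod>j\<in>UNIV. \<bar>z $ j\<bar> powr (- heat_exponent j))"
      by (rule prod_ennreal) simp
    also have "\<dots> \<ge> ennreal (norm (K z))"
      using heat_kernel_le[of z] nz heat_kernel_nonneg[of z] by (simp add: Kz ennreal_leI)
    finally show ?thesis
      by (rule order_trans) simp
  next
    case False
    have "ennreal (norm (K z)) \<le> ennreal B * indicator C z"
      using B[of z] C[of z] False by (cases "z \<in> C") (auto simp: ennreal_leI)
    then show ?thesis
      by (rule order_trans) simp
  qed
  have "(\<integral>\<^sup>+z. ennreal (norm (K z)) \<partial>lborel) \<le>
      (\<integral>\<^sup>+z. ennreal B * indicator C z + (\<Prod>j\<in>UNIV. f j (z $ j)) \<partial>lborel)"
    by (rule nn_integral_mono_AE) (use AE bound in \<open>auto elim: eventually_mono\<close>)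
  also have "\<dots> = (\<integral>\<^sup>+z. ennreal B * indicator C z \<partial>lborel) + (\<integral>\<^sup>+z. (\<Prod>j\<in>UNIV. f j (z $ j)) \<partial>lborel)"
    by (intro nn_integral_add) auto
  also have "\<dots> = ennreal B * emeasure lborel C + (\<Prod>j\<in>UNIV. \<integral>\<^sup>+u. f j u \<partial>lborel)"
    by (simp add: nn_integral_cmult_indicator nn_integral_vec_prod)
  also have "\<dots> < \<infinity>"
  proof -
    have "heat_exponent j < 1" for j :: "'d option"
      by (simp add: heat_exponent_def split: option.split)
    then have "(\<integral>\<^sup>+u. f j u \<partial>lborel) < \<infinity>" for j
      unfolding f_def using \<open>0 < r\<close> by (intro nn_integral_abs_powr_finite) auto
    moreover have "emeasure lborel C < \<infinity>"
      using \<open>compact C\<close> by (rule emeasure_compact_finite)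
    ultimately show ?thesis
      by (auto simp: ennreal_mult_eq_top_iff less_top[symmetric] ennreal_prod_eq_top)
  qed
  finally show ?thesis
    by (intro integrableI_bounded) auto
qed

lemma truncated_heat_kernel_integrable_kernel:
  assumes "truncated_heat_kernel K"
  obtains \<rho> where "integrable_kernel K \<rho>"
proof -
  obtain C where "compact C" and C: "\<And>z. z \<notin> C \<Longrightarrow> K z = 0"
    using assms unfolding truncated_heat_kernel_def by blast
  from compact_imp_bounded[OF \<open>compact C\<close>] obtain \<rho> where "\<forall>z\<in>C. norm z \<le> \<rho>"
    by (auto simp: bounded_iff)
  with C have "integrable_kernel K \<rho>"
    using truncated_heat_kernel_integrable[OF assms] by unfold_locales force+
  then show thesis by (rule that)
qed

text \<open>Whichever word \<open>SOME\<close> selects in \<open>Dmulti\<close>, the operator is a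
  \<open>partials js\<close> followed by convolution with K.\<close>

lemma cinf_linear_Dconv:
  assumes "truncated_heat_kernel K"
  shows "cinf_linear (Dconv a K)"
proof -
  obtain \<rho> where "integrable_kernel K \<rho>"
    using truncated_heat_kernel_integrable_kernel[OF assms] .
  then interpret integrable_kernel K \<rho> .
  have "Dconv a K = (\<lambda>f. conv (Dmulti a f))"
    by (simp add: Dconv_def conv_def fun_eq_iff)
  then show ?thesis
    using cinf_linear_compose[OF cinf_linear_conv cinf_linear_partials] by (simp add: Dmulti_def)
qed


section \<open>Linear extensions\<close>

text \<open>Different elements have different key sets; a common finite index set makes them
  comparable, the extra coefficients being 0.\<close>

lemma lin_fun_superset:
  assumes "finite S" and "Poly_Mapping.keys p \<subseteq> S"
  shows "lin_fun f p y = (\<Sum>b\<in>S. Poly_Mapping.lookup p b * f b y)"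
  unfolding lin_fun_def using assms by (intro sum.mono_neutral_left) (auto simp: in_keys_iff)

lemma lin_fun_zero [simp]: "lin_fun f 0 = (\<lambda>y. 0)"
  by (simp add: lin_fun_def)

lemma lin_fun_single: "lin_fun f (Poly_Mapping.single b c) y = c * f b y"
  by (simp add: lin_fun_def)

lemma lin_fun_vec1 [simp]: "lin_fun f (vec1 b) = f b"
  by (simp add: lin_fun_single fun_eq_iff)

lemma lin_fun_add: "lin_fun f (p + q) y = lin_fun f p y + lin_fun f q y"
proof -
  let ?S = "Poly_Mapping.keys p \<union> Poly_Mapping.keys q"
  have "Poly_Mapping.keys (p + q) \<subseteq> ?S"
    by (rule keys_add)
  then show ?thesis
    by (simp add: lin_fun_superset[of ?S] lookup_add distrib_right sum.distrib)
qed

lemma lin_fun_sum: "lin_fun f (\<Sum>i\<in>I. p i) y = (\<Sum>i\<in>I. lin_fun f (p i) y)"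
  by (induction I rule: infinite_finite_induct) (simp_all add: lin_fun_add)

lemma lin_fun_cong:
  assumes "\<And>b. b \<in> Poly_Mapping.keys p \<Longrightarrow> f b = g b"
  shows "lin_fun f p = lin_fun g p"
  by (simp add: lin_fun_def assms)

text \<open>Reads \<open>lin_ext\<close> coordinatewise as a \<open>lin_fun\<close>, so that
  identities for function-valued extensions carry over to vector-valued ones.\<close>

lemma lookup_lin_ext: "Poly_Mapping.lookup (lin_ext f p) = lin_fun (\<lambda>b. Poly_Mapping.lookup (f b)) p"
  by (rule ext) (auto simp: lin_ext_def lin_fun_def lookup_sum Poly_Mapping.map.rep_eq when_def intro!: sum.cong)

lemma keys_lin_ext: "Poly_Mapping.keys (lin_ext f p) \<subseteq> (\<Union>b\<in>Poly_Mapping.keys p. Poly_Mapping.keys (f b))"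
proof
  fix c assume "c \<in> Poly_Mapping.keys (lin_ext f p)"
  then have "(\<Sum>b\<in>Poly_Mapping.keys p. Poly_Mapping.lookup p b * Poly_Mapping.lookup (f b) c) \<noteq> 0"
    by (simp add: in_keys_iff lookup_lin_ext lin_fun_def)
  then obtain b where "b \<in> Poly_Mapping.keys p" "Poly_Mapping.lookup p b * Poly_Mapping.lookup (f b) c \<noteq> 0"
    by (rule sum.not_neutral_contains_not_neutral)
  then show "c \<in> (\<Union>b\<in>Poly_Mapping.keys p. Poly_Mapping.keys (f b))"
    by (auto simp: in_keys_iff)
qed

lemma lin_ext_cong:
  assumes "\<And>b. b \<in> Poly_Mapping.keys p \<Longrightarrow> f b = g b"
  shows "lin_ext f p = lin_ext g p"
  by (simp add: lin_ext_def assms)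

text \<open>Functoriality of linear extension; through it, identities such as R D = D R, stated
  between vectors, become identities between functions. The double sum runs over the union of all
  key sets, so its order can be exchanged.\<close>

lemma lin_fun_lin_ext: "lin_fun f (lin_ext g p) = lin_fun (\<lambda>b. lin_fun f (g b)) p"
proof
  fix y
  let ?S = "\<Union>b\<in>Poly_Mapping.keys p. Poly_Mapping.keys (g b)"
  have "lin_fun f (lin_ext g p) y =
      (\<Sum>c\<in>?S. \<Sum>b\<in>Poly_Mapping.keys p. Poly_Mapping.lookup p b * Poly_Mapping.lookup (g b) c * f c y)"
    by (subst lin_fun_superset[OF _ keys_lin_ext])
       (simp_all add: lookup_lin_ext lin_fun_def sum_distrib_right)
  also have "\<dots> = (\<Sum>b\<in>Poly_Mapping.keys p. \<Sum>c\<in>?S. Poly_Mapping.lookup p b * Poly_Mapping.lookup (g b) c * f c y)"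
    by (rule sum.swap)
  also have "\<dots> = (\<Sum>b\<in>Poly_Mapping.keys p. Poly_Mapping.lookup p b * lin_fun f (g b) y)"
  proof (intro sum.cong refl)
    fix b assume "b \<in> Poly_Mapping.keys p"
    then have "lin_fun f (g b) y = (\<Sum>c\<in>?S. Poly_Mapping.lookup (g b) c * f c y)"
      by (intro lin_fun_superset) auto
    then show "(\<Sum>c\<in>?S. Poly_Mapping.lookup p b * Poly_Mapping.lookup (g b) c * f c y) =
        Poly_Mapping.lookup p b * lin_fun f (g b) y"
      by (simp add: sum_distrib_left mult.assoc)
  qed
  finally show "lin_fun f (lin_ext g p) y = lin_fun (\<lambda>b. lin_fun f (g b)) p y"
    by (simp add: lin_fun_def)
qed

lemma lin_ext_lin_ext: "lin_ext f (lin_ext g p) = lin_ext (\<lambda>b. lin_ext f (g b)) p"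
  by (rule poly_mapping_eqI) (simp add: lookup_lin_ext lin_fun_lin_ext)

lemma sum_single_keys: "(\<Sum>b\<in>Poly_Mapping.keys p. Poly_Mapping.single b (Poly_Mapping.lookup p b)) = p"
  by (rule poly_mapping_eqI) (simp add: lookup_sum lookup_single when_def in_keys_iff)

text \<open>A character of the monoid of trees extends to an algebra homomorphism for the
  convolution product; it is applied to \<open>Pi_hat\<close>.\<close>

lemma lin_fun_mult:
  fixes p q :: "'b::comm_monoid_add \<Rightarrow>\<^sub>0 real"
  assumes f: "\<And>s t y. f (s + t) y = f s y * f t y"
  shows "lin_fun f (p * q) y = lin_fun f p y * lin_fun f q y"
proof -
  have "p * q = (\<Sum>b\<in>Poly_Mapping.keys p. \<Sum>c\<in>Poly_Mapping.keys q.
      Poly_Mapping.single (b + c) (Poly_Mapping.lookup p b * Poly_Mapping.lookup q c))"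
    by (subst sum_single_keys[of p, symmetric], subst sum_single_keys[of q, symmetric])
       (simp add: sum_product mult_single)
  then have "lin_fun f (p * q) y = (\<Sum>b\<in>Poly_Mapping.keys p. \<Sum>c\<in>Poly_Mapping.keys q.
      (Poly_Mapping.lookup p b * f b y) * (Poly_Mapping.lookup q c * f c y))"
    by (simp add: lin_fun_sum lin_fun_single f mult_ac)
  then show ?thesis
    by (simp add: lin_fun_def sum_product)
qed

lemma smooth_lin_fun:
  assumes "\<And>b. b \<in> Poly_Mapping.keys p \<Longrightarrow> smooth (f b)"
  shows "smooth (lin_fun f p)"
  unfolding lin_fun_def by (intro smooth_sum smooth_cmult assms)

lemma cinf_linear_lin_fun:
  assumes "cinf_linear A" and "\<And>b. b \<in> Poly_Mapping.keys p \<Longrightarrow> smooth (f b)"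
  shows "A (lin_fun f p) = lin_fun (\<lambda>b. A (f b)) p"
  unfolding lin_fun_def by (rule cinf_linear_sum[OF assms])

lemma has_cinf_derivative_lin_fun:
  assumes "\<And>b. b \<in> Poly_Mapping.keys p \<Longrightarrow> has_cinf_derivative (\<Phi> b) (L b) \<xi>" and "smooth \<xi>"
  shows "has_cinf_derivative (\<lambda>\<zeta>. lin_fun (\<lambda>b. \<Phi> b \<zeta>) p) (\<lambda>h. lin_fun (\<lambda>b. L b h) p) \<xi>"
  unfolding lin_fun_def by (rule has_cinf_derivative_sum[OF assms])


section \<open>Trees\<close>

lemma Node_add_mset: "Node k (add_mset c M) = Node 0 {#c#} + Node k M"
  by simp

section \<open>Trees occurring in \<open>D_Xi\<close> and their degrees\<close>

lemma keys_sum_mset: "Poly_Mapping.keys (\<Sum>c\<in>#M. f c) \<subseteq> (\<Union>c\<in>set_mset M. Poly_Mapping.keys (f c))"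
  by (induction M) (use keys_add in fastforce)+

text \<open>Each term of the Leibniz sum removes one root edge and puts back a modified one.
  Coefficients are forgotten, as only membership and degree of the terms matter later.\<close>

lemma keys_D_Xi:
  assumes "u \<in> Poly_Mapping.keys (D_Xi (Node k M))"
  shows "\<exists>e t N. M = add_mset (e, t) N \<and>
    (fst e = Kern \<and> (\<exists>s\<in>Poly_Mapping.keys (D_Xi t). u = Node k (add_mset (e, s) N)) \<or>
     fst e = Xi0 \<and> u = Node k (add_mset ((Xi1, snd e), t) N))"
proof -
  obtain e t where et: "(e, t) \<in># M" and u: "u \<in> Poly_Mapping.keys (vec1 (Node k (M - {#(e, t)#})) *
     (case fst e of
        Kern \<Rightarrow> lin_ext (\<lambda>s. vec1 (plant (snd e) s)) (D_Xi t)
      | Xi0 \<Rightarrow> vec1 (Node 0 {#((Xi1, snd e), t)#})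
      | Xi1 \<Rightarrow> 0))" (is "u \<in> Poly_Mapping.keys (vec1 ?N * ?q)")
    using assms subsetD[OF keys_sum_mset] by fastforce
  obtain v where v: "v \<in> Poly_Mapping.keys ?q" and uv: "u = ?N + v"
    using subsetD[OF keys_mult u] by auto
  have M: "M = add_mset (e, t) (M - {#(e, t)#})"
    using et by simp
  have "fst e = Kern \<and> (\<exists>s\<in>Poly_Mapping.keys (D_Xi t). u = Node k (add_mset (e, s) (M - {#(e, t)#}))) \<or>
     fst e = Xi0 \<and> u = Node k (add_mset ((Xi1, snd e), t) (M - {#(e, t)#}))"
  proof (cases "fst e")
    case Kern
    then obtain s where "s \<in> Poly_Mapping.keys (D_Xi t)" "v = plant (snd e) s"
      using v subsetD[OF keys_lin_ext] by fastforce
    then have "u = Node k (add_mset (e, s) (M - {#(e, t)#}))"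
      using Kern uv by (cases e) (simp add: plant_def)
    with Kern \<open>s \<in> Poly_Mapping.keys (D_Xi t)\<close> show ?thesis by blast
  qed (use v uv in auto)
  with M show ?thesis by blast
qed

lemma trees_Node_iff:
  "Node k M \<in> trees \<longleftrightarrow> size {#c \<in># M. fst (fst c) \<noteq> Kern#} \<le> 1 \<and>
    (\<forall>e a t. ((e, a), t) \<in># M \<longrightarrow> (if e = Kern then t \<in> trees else a = 0 \<and> t = 0))"
  by (subst trees.simps) auto

text \<open>Turning one \<open>Xi0\<close> into \<open>Xi1\<close> keeps the number of noise edges
  at each node, hence membership in \<open>trees\<close>, and keeps \<open>deg \<alpha> 1\<close>,
  where both noises weigh \<alpha>. With \<open>deg \<alpha> 0\<close> the degree would jump by (d +
  2) / 2 and with it the order of the Taylor jets.\<close>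

lemma D_Xi_trees:
  assumes "t \<in> trees" and "u \<in> Poly_Mapping.keys (D_Xi t)"
  shows "u \<in> trees \<and> deg \<alpha> 1 u = deg \<alpha> 1 t"
  using assms
proof (induction t arbitrary: u)
  case (1 M k)
  have M_trees: "Node k M \<in> trees"
    by (rule trees.intros) (use 1 in blast)+
  obtain e t N where M: "M = add_mset (e, t) N" and
    u: "fst e = Kern \<and> (\<exists>s\<in>Poly_Mapping.keys (D_Xi t). u = Node k (add_mset (e, s) N)) \<or>
     fst e = Xi0 \<and> u = Node k (add_mset ((Xi1, snd e), t) N)"
    using keys_D_Xi[OF 1(5)] by blast
  from u show ?case
  proof
    assume "fst e = Kern \<and> (\<exists>s\<in>Poly_Mapping.keys (D_Xi t). u = Node k (add_mset (e, s) N))"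
    then obtain s where e: "e = (Kern, snd e)" and s: "s \<in> Poly_Mapping.keys (D_Xi t)"
      and u: "u = Node k (add_mset (e, s) N)"
      by (auto simp: prod_eq_iff)
    have "((Kern, snd e), t) \<in># M"
      using M e by simp
    from "1.IH"[OF this s] have "s \<in> trees" "deg \<alpha> 1 s = deg \<alpha> 1 t" by auto
    with M_trees e show ?thesis
      unfolding u M by (cases e) (auto simp: trees_Node_iff split: if_splits)
  next
    assume "fst e = Xi0 \<and> u = Node k (add_mset ((Xi1, snd e), t) N)"
    with M_trees show ?thesis
      unfolding M by (cases e) (auto simp: trees_Node_iff split: if_splits)
  qed
qed

text \<open>The preparation map may reproduce \<open>t\<close> itself in \<open>R t\<close>, so the induction is on the number of
  noises and then on the size.\<close>

lemma recursive_tree_induct [consumes 1, case_names child R Xpow noise plus plant]: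
  fixes R :: "'d::finite tree \<Rightarrow> 'd tree \<Rightarrow>\<^sub>0 real"
  assumes "\<tau> \<in> S"
    and child: "\<And>k M c. Node k M \<in> S \<Longrightarrow> c \<in># M \<Longrightarrow>
      (\<exists>e\<in>E. c = ((e, 0), 0)) \<or> (\<exists>a t. c = ((Kern, a), t) \<and> t \<in> S)"
    and R: "\<And>t s. t \<in> S \<Longrightarrow> s \<in> Poly_Mapping.keys (R t) \<Longrightarrow> s \<in> S \<and> (s = t \<or> noises s < noises t)"
    and Xpow: "\<And>k. P (Xpow k)"
    and noise: "\<And>e. e \<in> E \<Longrightarrow> P (noise e)"
    and plus: "\<And>s t. P s \<Longrightarrow> P t \<Longrightarrow> P (s + t)"
    and plant: "\<And>a t. t \<in> S \<Longrightarrow> (\<And>s. s \<in> Poly_Mapping.keys (R t) \<Longrightarrow> P s) \<Longrightarrow> P (plant a t)"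
  shows "P \<tau>"
proof -
  have "wf (measures [noises, size :: 'd tree \<Rightarrow> nat])" by simp
  then show ?thesis
    using \<open>\<tau> \<in> S\<close>
  proof (induction \<tau> rule: wf_induct_rule)
    case (less \<tau>)
    obtain k M where \<tau>: "\<tau> = Node k M" by (cases \<tau>)
    have single: "P (Node 0 {#c#})" if c: "c \<in># M" for c
      using child[OF less.prems[unfolded \<tau>] c]
    proof (elim disjE exE bexE conjE)
      fix e assume "e \<in> E" "c = ((e, 0), 0)"
      then show ?thesis
        using noise[of e] by (simp add: noise_def)
    next
      fix a t assume ct: "c = ((Kern, a), t)" and t: "t \<in> S"
      have "P s" if s: "s \<in> Poly_Mapping.keys (R t)" for s
      proof (rule less.IH)
        show "s \<in> S" using R[OF t s] by blast
        \<comment> \<open>For s = t the size decreases while the noises do not increase; every other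
          term of R t has strictly fewer noises, whatever its size.\<close>
        have "noises t \<le> noises \<tau>" "size t < size \<tau>"
          using c noises_child[of "(Kern, a)" t M k] size_child'[of "(Kern, a)" t M]
          by (simp_all add: \<tau> ct)
        with R[OF t s] show "(s, \<tau>) \<in> measures [noises, size]"
          by (auto simp del: noises.simps)
      qed
      from plant[OF t this] show ?thesis
        by (simp add: ct plant_def)
    qed
    \<comment> \<open>The tree is rebuilt as a product: X^k first, then one single-edge factor for
      each root edge.\<close>
    have "P (Node k N)" if "N \<subseteq># M" for N
      using that
    proof (induction N)
      case empty
      then show ?case using Xpow[of k] by (simp add: Xpow_def)
    next
      case (add c N)
      then have "c \<in># M" "N \<subseteq># M"
        by (auto dest: mset_subset_eq_insertD)
      with add.IH show ?case
        by (subst Node_add_mset) (intro plus single)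
    qed
    then show ?case by (simp add: \<tau>)
  qed
qed

section \<open>Branches of trees in \<open>trees\<close> and \<open>T0\<close>, and the terms of
  R\<close>

lemma trees_child:
  assumes "Node k M \<in> trees" and "c \<in># M"
  shows "(\<exists>e\<in>{Xi0, Xi1}. c = ((e, 0), 0)) \<or> (\<exists>a t. c = ((Kern, a), t) \<and> t \<in> trees)"
proof -
  obtain e a t where c: "c = ((e, a), t)" by (metis surj_pair)
  with assms show ?thesis
    by (cases e) (auto simp: trees_Node_iff split: if_splits)
qed

lemma conforms_Node_iff:
  "conforms rl b (Node k M) \<longleftrightarrow> image_mset fst M \<in> rl b \<and> (\<forall>e a s. ((e, a), s) \<in># M \<longrightarrow> conforms rl e s)"
  by (subst conforms.simps) simp

text \<open>A node with an outgoing edge cannot have the type allowed after a noise, which is only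
  the empty one. So its type is allowed for \<open>Kern\<close>, which leaves only
  \<open>Kern\<close> and \<open>Xi0\<close> edges; this is how \<open>Xi1\<close> is excluded from
  \<open>T0\<close>.\<close>

lemma T0_child:
  assumes rule: "spde_rule rl" and M: "Node k M \<in> T0 rl" and c: "c \<in># M"
  shows "(\<exists>e\<in>{Xi0}. c = ((e, 0), 0)) \<or> (\<exists>a t. c = ((Kern, a), t) \<and> t \<in> T0 rl)"
proof -
  obtain e a t where c_eq: "c = ((e, a), t)" by (metis surj_pair)
  have rl: "rl Xi0 = {{#}}" "\<forall>N\<in>rl Kern. \<exists>A. N = image_mset (Pair Kern) A \<or> N = add_mset (Xi0, 0) (image_mset (Pair Kern) A)"
    using rule unfolding spde_rule_def by (rule conjunct1, rule conjunct2)
  obtain b where b: "b \<in> {Kern, Xi0}" "conforms rl b (Node k M)" and M_trees: "Node k M \<in> trees"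
    using M unfolding T0_def by blast
  define N where "N = image_mset fst M"
  have N: "N \<in> rl b" and sub: "conforms rl e t"
    using b(2) c by (simp_all add: conforms_Node_iff N_def c_eq)
  have ea: "(e, a) \<in># N"
    unfolding N_def set_image_mset using c by (rule rev_image_eqI) (simp add: c_eq)
  have "b \<noteq> Xi0"
  proof
    assume "b = Xi0"
    with N rl(1) have "N = {#}" by simp
    with ea show False by simp
  qed
  with b(1) N have "N \<in> rl Kern" by simp
  with rl(2) obtain A where
    "N = image_mset (Pair Kern) A \<or> N = add_mset (Xi0, 0) (image_mset (Pair Kern) A)"
    by (meson bspec)
  with ea have "e = Kern \<or> e = Xi0"
    by auto
  moreover have "(\<exists>e'\<in>{Xi0, Xi1}. c = ((e', 0), 0)) \<or> (\<exists>a t. c = ((Kern, a), t) \<and> t \<in> trees)"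
    by (rule trees_child[OF M_trees c])
  ultimately show ?thesis
    using sub unfolding c_eq T0_def by (elim disjE bexE exE conjE) auto
qed

lemma preparation_mapD:
  assumes "preparation_map \<alpha> rl R"
  shows "\<forall>t\<in>trees. Poly_Mapping.keys (R t) \<subseteq> trees"
    and "\<forall>t\<in>trees. \<forall>s\<in>Poly_Mapping.keys (R t - vec1 t). deg \<alpha> 1 s \<ge> deg \<alpha> 1 t \<and> noises s < noises t"
    and "\<forall>t\<in>T0 rl. lin_ext R (D_Xi t) = lin_ext D_Xi (R t)"
    and "\<forall>t\<in>T0 rl. Poly_Mapping.keys (R t) \<subseteq> T0 rl"
  by (insert assms[unfolded preparation_map_def], (elim conjE; assumption)+)

lemma preparation_map_keys:
  assumes "preparation_map \<alpha> rl R" and "t \<in> trees" and "s \<in> Poly_Mapping.keys (R t)"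
  shows "s \<in> trees \<and> (s = t \<or> noises s < noises t)"
proof (cases "s = t")
  case False
  then have "s \<in> Poly_Mapping.keys (R t - vec1 t)"
    using assms(3) by (simp add: in_keys_iff lookup_minus lookup_single when_def)
  then show ?thesis
    using preparation_mapD(1,2)[OF assms(1)] assms(2,3) by blast
qed (use assms in simp)

lemma preparation_map_keys_T0:
  assumes "preparation_map \<alpha> rl R" and "t \<in> T0 rl" and "s \<in> Poly_Mapping.keys (R t)"
  shows "s \<in> T0 rl \<and> (s = t \<or> noises s < noises t)"
proof
  show "s \<in> T0 rl"
    using preparation_mapD(4)[OF assms(1)] assms(2,3) by blast
  have "t \<in> trees"
    using assms(2) unfolding T0_def by blast
  from preparation_map_keys[OF assms(1) this assms(3)] show "s = t \<or> noises s < noises t"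
    by blast
qed


section \<open>The derivative of the model\<close>

text \<open>\<open>D\<close> is the degree of the planted tree. Since \<open>\<Xi>\<^sub>0\<close> and \<open>\<Xi>\<^sub>1\<close> have the same \<open>deg\<^sub>1\<close>, the operator is the
  same for \<open>\<I>\<^sub>a(\<tau>)\<close> and for all terms of \<open>\<I>\<^sub>a(D\<^sub>\<Xi> \<tau>)\<close>.\<close>

definition plant_op :: "('d::finite st \<Rightarrow> real) \<Rightarrow> 'd st \<Rightarrow> real \<Rightarrow> 'd mi \<Rightarrow> ('d st \<Rightarrow> real) \<Rightarrow> 'd st \<Rightarrow> real" where
  "plant_op K x D a f = (\<lambda>y. Dconv a K f y -
     (\<Sum>m\<in>{m. real (sdeg m) < D}. mpow (y - x) m / mfact m * Dconv (a + m) K f x))"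

lemma cinf_linear_plant_op:
  assumes "truncated_heat_kernel K"
  shows "cinf_linear (plant_op K x D a)"
proof -
  have "smooth (\<lambda>y. mpow (y - x) m / mfact m)" for m
    using smooth_cmult[OF smooth_mpow, of "1 / mfact m" x m] by simp
  then have "cinf_linear (\<lambda>h y. mpow (y - x) m / mfact m * Dconv (a + m) K h x)" for m
    using cinf_linear_compose[OF cinf_linear_mult
        cinf_linear_compose[OF cinf_linear_eval cinf_linear_Dconv[OF assms]]] by blast
  then have "cinf_linear (\<lambda>h y. \<Sum>m\<in>{m. real (sdeg m) < D}. mpow (y - x) m / mfact m * Dconv (a + m) K h x)"
    by (intro cinf_linear_Sum)
  then have "cinf_linear (\<lambda>h y. -1 * (\<Sum>m\<in>{m. real (sdeg m) < D}. mpow (y - x) m / mfact m * Dconv (a + m) K h x))"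
    by (rule cinf_linear_compose[OF cinf_linear_mult, rotated]) simp
  from cinf_linear_plus[OF cinf_linear_Dconv[OF assms, of a] this] show ?thesis
    by (simp add: plant_op_def[abs_def])
qed

lemma Pi_hat_plant_op:
  assumes "preparation_map \<alpha> rl R" and "t \<in> trees"
  shows "Pi_hat \<alpha> K R \<xi> \<eta> x (plant a t) =
    plant_op K x (deg \<alpha> 1 (plant a t)) a (lin_fun (Pi_hat \<alpha> K R \<xi> \<eta> x) (R t))"
  by (rule ext) (simp add: Pi_hat_plant[OF assms] plant_op_def Pi_R_def)

lemma Pi_hat_plus:
  "Pi_hat \<alpha> K R \<xi> \<eta> x (s + t) = (\<lambda>y. Pi_hat \<alpha> K R \<xi> \<eta> x s y * Pi_hat \<alpha> K R \<xi> \<eta> x t y)"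
  by (rule ext) (rule Pi_hat_mult)

text \<open>Stated for all of \<open>trees\<close>, because it has to cover the terms of
  \<open>D_Xi t\<close>, which contain \<open>Xi1\<close>.\<close>

lemma smooth_Pi_hat:
  assumes R: "preparation_map \<alpha> rl R" and K: "truncated_heat_kernel K"
    and "smooth \<xi>" and "smooth \<eta>" and "t \<in> trees"
  shows "smooth (Pi_hat \<alpha> K R \<xi> \<eta> x t)"
  using \<open>t \<in> trees\<close>
proof (induction rule: recursive_tree_induct[where R = R and E = "{Xi0, Xi1}"])
  case (child k M c)
  then show ?case by (rule trees_child)
next
  case (R t s)
  then show ?case by (rule preparation_map_keys[OF assms(1)])
next
  case (Xpow k)
  have "Pi_hat \<alpha> K R \<xi> \<eta> x (Xpow k) = (\<lambda>y. mpow (y - x) k)"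
    by (rule ext) (rule Pi_hat_X)
  then show ?case by (simp add: smooth_mpow)
next
  case (noise e)
  then show ?case using assms by (auto simp: Pi_hat_Xi0 Pi_hat_Xi1)
next
  case (plus s t)
  then show ?case by (simp add: Pi_hat_plus smooth_mult)
next
  case (plant a t)
  then show ?case
    unfolding Pi_hat_plant_op[OF assms(1) plant(1)]
    by (intro cinf_linear_smooth[OF cinf_linear_plant_op[OF K]] smooth_lin_fun)
qed

text \<open>All terms of \<open>D_Xi t\<close> have the degree of t, so a single operator can be
  pulled out of their linear combination; what remains inside is the model on R D t, rewritten as D
  R t. The right-hand side is then the operator applied to derivatives known by induction.\<close>

lemma lin_fun_Pi_hat_D_Xi_plant:
  assumes R: "preparation_map \<alpha> rl R" and K: "truncated_heat_kernel K"
    and \<xi>: "smooth \<xi>" and h: "smooth h" and t: "t \<in> T0 rl"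
  shows "lin_fun (Pi_hat \<alpha> K R \<xi> h x) (D_Xi (plant a t)) =
    plant_op K x (deg \<alpha> 1 (plant a t)) a
      (lin_fun (\<lambda>s. lin_fun (Pi_hat \<alpha> K R \<xi> h x) (D_Xi s)) (R t))"
proof -
  let ?\<Pi> = "Pi_hat \<alpha> K R \<xi> h x" and ?A = "plant_op K x (deg \<alpha> 1 (plant a t)) a"
  have t_trees: "t \<in> trees"
    using t unfolding T0_def by blast
  have comm: "lin_ext R (D_Xi t) = lin_ext D_Xi (R t)"
    using t preparation_mapD(3)[OF R] by blast
  have "lin_fun ?\<Pi> (D_Xi (plant a t)) = lin_fun (\<lambda>u. ?\<Pi> (plant a u)) (D_Xi t)"
    by (simp add: D_Xi_plant lin_fun_lin_ext)
  also have "\<dots> = lin_fun (\<lambda>u. ?A (lin_fun ?\<Pi> (R u))) (D_Xi t)"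
  proof (rule lin_fun_cong)
    fix u assume "u \<in> Poly_Mapping.keys (D_Xi t)"
    then have u: "u \<in> trees" "deg \<alpha> 1 u = deg \<alpha> 1 t"
      using D_Xi_trees[OF t_trees, of u \<alpha>] by auto
    then have "deg \<alpha> 1 (plant a u) = deg \<alpha> 1 (plant a t)"
      by (simp add: plant_def)
    then show "?\<Pi> (plant a u) = ?A (lin_fun ?\<Pi> (R u))"
      by (simp only: Pi_hat_plant_op[OF R u(1)])
  qed
  also have "\<dots> = ?A (lin_fun (\<lambda>u. lin_fun ?\<Pi> (R u)) (D_Xi t))"
  proof (rule cinf_linear_lin_fun[OF cinf_linear_plant_op[OF K], symmetric])
    fix u assume "u \<in> Poly_Mapping.keys (D_Xi t)"
    then have "u \<in> trees"
      using D_Xi_trees[OF t_trees, of u \<alpha>] by auto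
    then show "smooth (lin_fun ?\<Pi> (R u))"
      using preparation_map_keys[OF R] by (intro smooth_lin_fun smooth_Pi_hat[OF R K \<xi> h]) auto
  qed
  also have "lin_fun (\<lambda>u. lin_fun ?\<Pi> (R u)) (D_Xi t) = lin_fun ?\<Pi> (lin_ext D_Xi (R t))"
    by (simp only: lin_fun_lin_ext[symmetric] comm)
  also have "\<dots> = lin_fun (\<lambda>s. lin_fun ?\<Pi> (D_Xi s)) (R t)"
    by (rule lin_fun_lin_ext)
  finally show ?thesis .
qed

text \<open>The first conjunct strengthens the induction: the product rule needs the factors to
  agree for all second arguments, not only for the given \<eta>.\<close>

lemma Pi_hat_derivative:
  assumes rule: "spde_rule rl" and R: "preparation_map \<alpha> rl R" and K: "truncated_heat_kernel K"
    and \<xi>: "smooth \<xi>" and "t \<in> T0 rl"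
  shows "(\<forall>\<zeta> h. Pi_hat \<alpha> K R \<zeta> h x t = Pi_hat \<alpha> K R \<zeta> \<eta> x t) \<and>
    has_cinf_derivative (\<lambda>\<zeta>. Pi_hat \<alpha> K R \<zeta> \<eta> x t) (\<lambda>h. lin_fun (Pi_hat \<alpha> K R \<xi> h x) (D_Xi t)) \<xi>"
  using \<open>t \<in> T0 rl\<close>
proof (induction rule: recursive_tree_induct[where R = R and E = "{Xi0}"])
  case (child k M c)
  then show ?case by (rule T0_child[OF rule])
next
  case (R t s)
  then show ?case by (rule preparation_map_keys_T0[OF assms(2)])
next
  case (Xpow k)
  have X: "Pi_hat \<alpha> K R \<zeta> h x (Xpow k) = (\<lambda>y. mpow (y - x) k)" for \<zeta> h
    by (rule ext) (rule Pi_hat_X)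
  show ?case
    by (simp add: X D_Xi_X has_cinf_derivative_const smooth_mpow)
next
  case (noise e)
  then show ?case
    by (simp add: Pi_hat_Xi0 D_Xi_noise Pi_hat_Xi1 has_cinf_derivative_ident)
next
  case (plus s t)
  then have indep: "Pi_hat \<alpha> K R \<zeta> h x s = Pi_hat \<alpha> K R \<zeta> \<eta> x s" "Pi_hat \<alpha> K R \<zeta> h x t = Pi_hat \<alpha> K R \<zeta> \<eta> x t" for \<zeta> h
    by blast+
  \<comment> \<open>The undifferentiated factor arises with h in the second slot and is replaced by
    its value with \<eta>, the form that the product rule requires.\<close>
  have "lin_fun (Pi_hat \<alpha> K R \<xi> h x) (D_Xi (s + t)) =
      (\<lambda>y. lin_fun (Pi_hat \<alpha> K R \<xi> h x) (D_Xi s) y * Pi_hat \<alpha> K R \<xi> \<eta> x t y +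
           Pi_hat \<alpha> K R \<xi> \<eta> x s y * lin_fun (Pi_hat \<alpha> K R \<xi> h x) (D_Xi t) y)" for h
    by (rule ext) (simp add: D_Xi_Leibniz lin_fun_add lin_fun_mult Pi_hat_mult indep[of _ h])
  then have "has_cinf_derivative (\<lambda>\<zeta>. Pi_hat \<alpha> K R \<zeta> \<eta> x (s + t))
      (\<lambda>h. lin_fun (Pi_hat \<alpha> K R \<xi> h x) (D_Xi (s + t))) \<xi>"
    unfolding Pi_hat_plus using plus by (auto intro: has_cinf_derivative_mult \<xi>)
  moreover have "Pi_hat \<alpha> K R \<zeta> h x (s + t) = Pi_hat \<alpha> K R \<zeta> \<eta> x (s + t)" for \<zeta> h
    unfolding Pi_hat_plus indep[of _ h] ..
  ultimately show ?case by blast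
next
  case (plant a t)
  then have t_trees: "t \<in> trees" by (simp add: T0_def)
  have indep: "lin_fun (Pi_hat \<alpha> K R \<zeta> h x) (R t) = lin_fun (Pi_hat \<alpha> K R \<zeta> \<eta> x) (R t)" for \<zeta> h
    using plant(2) by (intro lin_fun_cong) blast
  have "Pi_hat \<alpha> K R \<zeta> h x (plant a t) = Pi_hat \<alpha> K R \<zeta> \<eta> x (plant a t)" for \<zeta> h
    unfolding Pi_hat_plant_op[OF assms(2) t_trees] indep[of _ h] ..
  moreover have "has_cinf_derivative (\<lambda>\<zeta>. Pi_hat \<alpha> K R \<zeta> \<eta> x (plant a t))
      (\<lambda>h. lin_fun (Pi_hat \<alpha> K R \<xi> h x) (D_Xi (plant a t))) \<xi>"
  proof (rule has_cinf_derivative_cong)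
    show "has_cinf_derivative
        (\<lambda>\<zeta>. plant_op K x (deg \<alpha> 1 (plant a t)) a (lin_fun (\<lambda>s. Pi_hat \<alpha> K R \<zeta> \<eta> x s) (R t)))
        (\<lambda>h. plant_op K x (deg \<alpha> 1 (plant a t)) a
          (lin_fun (\<lambda>s. lin_fun (Pi_hat \<alpha> K R \<xi> h x) (D_Xi s)) (R t))) \<xi>"
      using plant(2)
      by (intro has_cinf_derivative_compose[OF cinf_linear_plant_op[OF K]] has_cinf_derivative_lin_fun \<xi>) blast
  qed (simp_all only: Pi_hat_plant_op[OF assms(2) t_trees] lin_fun_Pi_hat_D_Xi_plant[OF assms(2) K \<xi> _ plant(1)])
  ultimately show ?case by blast
qed

theorem proposition4p1:
  fixes \<alpha> :: real
    and rl :: "'d::finite srule"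
    and R :: "'d tree \<Rightarrow> 'd tree \<Rightarrow>\<^sub>0 real"
    and K \<xi> \<eta> :: "'d st \<Rightarrow> real"
    and x :: "'d st"
    and \<tau> :: "'d tree \<Rightarrow>\<^sub>0 real"
  assumes "spde_rule rl" and "normal_rule rl" and "subcritical_rule \<alpha> rl" and "complete_rule \<alpha> rl"
    and "preparation_map \<alpha> rl R"
    and "truncated_heat_kernel K"
    and "smooth \<xi>" and "smooth \<eta>"
    and "Poly_Mapping.keys \<tau> \<subseteq> T0 rl"
  shows "has_cinf_derivative
           (\<lambda>\<zeta>. Pi_R \<alpha> K R \<zeta> \<eta> x \<tau>)
           (\<lambda>h. Pi_R \<alpha> K R \<xi> h x (lin_ext D_Xi \<tau>)) \<xi>"
proof -
  note R = assms(5)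
  \<comment> \<open>\<open>Pi_R\<close> applies R last, after \<open>D_Xi\<close>; commuting them
    gives a linear combination of derivatives on trees in R \<tau>, which still lie in
    \<open>T0\<close>.\<close>
  have "lin_ext D_Xi (lin_ext R \<tau>) = lin_ext R (lin_ext D_Xi \<tau>)"
    unfolding lin_ext_lin_ext using preparation_mapD(3)[OF R] assms(9) by (intro lin_ext_cong) (auto simp: subset_iff)
  then have L: "Pi_R \<alpha> K R \<xi> h x (lin_ext D_Xi \<tau>) =
      lin_fun (\<lambda>s. lin_fun (Pi_hat \<alpha> K R \<xi> h x) (D_Xi s)) (lin_ext R \<tau>)" for h
    by (simp only: Pi_R_def lin_fun_lin_ext[symmetric])
  have keys: "s \<in> T0 rl" if "s \<in> Poly_Mapping.keys (lin_ext R \<tau>)" for s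
    using subsetD[OF keys_lin_ext that] preparation_map_keys_T0[OF R] assms(9) by blast
  show ?thesis
    unfolding L unfolding Pi_R_def
    using Pi_hat_derivative[OF assms(1,5,6,7)] keys
    by (intro has_cinf_derivative_lin_fun assms(7)) blast
qed

end
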